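(* Let $m,r\in\mathbb{N}$, and let $\varepsilon>0$ and $\delta>0$ be arbitrary. Let $B\subset\mathbb{R}^r$ be bounded, open, and measurable. Let $K\subset\mathcal{U}_{\delta,B}$ be compact in $L^1(\mathbb{R}^m\times\mathbb{R}^r)$. Then there exist $R>0$ and a full space neural operator $\Psi:L^1(\mathbb{R}^m\times\mathbb{R}^r)\to L^1(\mathbb{R}^m\times\mathbb{R}^r)$ with truncation sets $\Omega=\Omega'=(-R,R)^{m+r}$ such that $$\sup_{\rho\in K}\|\mathcal{G}^\star(\rho)-\Psi(\rho)\|_{L^1(\mathbb{R}^m\times B)}\le\varepsilon .$$
   Context: All functions are real-valued. **Densities and conditioning.** $L^1_{\mathrm{ac}}(\mathbb{R}^n)$ is the set of Lebesgue probability density functions on $\mathbb{R}^n$. For $f\in L^1_{\mathrm{ac}}(\mathbb{R}^m\times\mathbb{R}^r)$, $m_f(y)=\int_{\mathbb{R}^m}f(x,y)\,dx$. Set $\mathcal{U}_{\delta,B}=\{f\in L^1_{\mathrm{ac}}(\mathbb{R}^m\times\mathbb{R}^r):\operatorname{ess\,inf}_{y\in B}m_f(y)\ge\delta\}$. The kernel conditioning operator is $\mathcal{G}^\star:\mathcal{U}_{\delta,B}\to L^1(\mathbb{R}^m\times B)$, $\mathcal{G}^\star(\rho)(x,y)=\rho(x,y)/m_\rho(y)$ for $(x,y)\in\mathbb{R}^m\times B$. In the claim, $\Psi(\rho)$ is restricted to $\mathbb{R}^m\times B$. **Full space neural operators.** For measurable $\Omega\subset\mathbb{R}^n$, $\mathcal{Z}_\Omega:L^1(\Omega)\to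 L^1(\mathbb{R}^n)$ is extension by zero and $\mathcal{R}_\Omega:L^1(\mathbb{R}^n)\to L^1(\Omega)$ is restriction. A full space neural operator between $L^1(\mathbb{R}^d)$ and $L^1(\mathbb{R}^{d'})$ with truncation sets $\Omega\subset\mathbb{R}^d$ and $\Omega'\subset\mathbb{R}^{d'}$ is a map of the form $\Psi=\mathcal{Z}_{\Omega'}\circ\Psi_0\circ S\circ\mathcal{R}_\Omega$, where $\Psi_0:L^1(\Omega)\to L^1(\Omega')$ is a neural operator (defined next) and $S:\mathbb{R}\to\mathbb{R}$ is a shallow (one hidden layer) ReLU neural network acting pointwise, $S(f)(x)=S(f(x))$. **Neural operators.** A neural network is a standard feedforward neural network between finite-dimensional spaces. Let $\Omega\subset\mathbb{R}^{n}$ be a Lipschitz domain and let $\mathcal{F}_{\mathrm{in}},\mathcal{F}_{\mathrm{out}}$ be collections of functions $\Omega\to\mathbb{R}^{d_{\mathrm{in}}}$ and $\Omega\to\mathbb{R}^{d_{\mathrm{out}}}$ (here both are $L^1(\Omega)$, $n=m+r$, $d_{\mathrm{in}}=d_{\mathrm{out}}=1$). A neural operator of depth $L>0$ is a map $\mathcal{Q}\circ\mathcal{L}_L\circ\cdots\circ\mathcal{L}_1\circ\mathcal{R}:\mathcal{F}_{\mathrm{in}}\to\mathcal{F}_{\mathrm{out}}$ where, for some $d_0,\dots,d_L\in\mathbb{N}$ and collections $\mathcal{F}_\ell$ of functions $\Omega\to\mathbb{R}^{d_\ell}$: - (lifting layer) $\mathcal{R}:\mathcal{F}_{\mathrm{in}}\to\mathcal{F}_0$,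 $\mathcal{R}(f)(x)=R(x,f(x))$ with $R:\mathbb{R}^{n+d_{\mathrm{in}}}\to\mathbb{R}^{d_0}$ a neural network; - (hidden layers) $\mathcal{L}_\ell:\mathcal{F}_{\ell-1}\to\mathcal{F}_\ell$, $\mathcal{L}_\ell(f)(x)=\sigma\bigl(W_\ell f(x)+b_\ell+\sum_{j=1}^{M_\ell}\langle T_{\ell,j}f,\psi_{\ell,j}\rangle\,\phi_{\ell,j}(x)\bigr)$, where $\sigma:\mathbb{R}\to\mathbb{R}$ is a nonlinearity (activation function) applied componentwise, $W_\ell\in\mathbb{R}^{d_\ell\times d_{\ell-1}}$, $b_\ell\in\mathbb{R}^{d_\ell}$, $T_{\ell,j}:\mathbb{R}^{d_{\ell-1}}\to\mathbb{R}^{d_\ell}$ is linear and applied pointwise, $\psi_{\ell,j}:\Omega\to\mathbb{R}^{d_\ell}$ (encoding functions) and $\phi_{\ell,j}\in\mathcal{F}_\ell$ (decoding functions) are fixed functions, and $\langle u,v\rangle=\int_\Omega u(x)\cdot v(x)\,dx$; - (projection layer) $\mathcal{Q}:\mathcal{F}_L\to\mathcal{F}_{\mathrm{out}}$, $\mathcal{Q}(f)(x)=Q(x,f(x))$ with $Q:\mathbb{R}^{n+d_L}\to\mathbb{R}^{d_{\mathrm{out}}}$ a neural network. When the neural operator has $\Omega_{\mathrm{in}}=\Omega_{\mathrm{out}}=\Omega$, as here, all layers act on functions on $\Omega$. All ingredients are such that these layers are well-defined maps between the indicated spaces. *)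

theory Defs
  imports "HOL-Analysis.Analysis" "Jordan_Normal_Form.Matrix"
begin

hide_type (open) Finite_Cartesian_Product.vec
hide_const (open) Finite_Cartesian_Product.vec Finite_Cartesian_Product.mat

unbundle no inner_syntax
unbundle no vec_syntax
notation scalar_prod (infix \<open>\<bullet>\<close> 70)

section \<open>The space \<open>L\<^sup>1(\<Omega>)\<close>\<close>

text \<open>
  Elements of \<open>L\<^sup>1(\<Omega>)\<close> are given by representatives, not by classes modulo equality almost
  everywhere.  A function on \<open>\<Omega>\<close> is a function on the whole type that is \<^const>\<open>undefined\<close>
  outside \<open>\<Omega>\<close> (no condition if \<open>\<Omega> = UNIV\<close>).
\<close>

definition L1 :: "'a::euclidean_space set \<Rightarrow> ('a \<Rightarrow> real) set" where
  "L1 \<Omega> = {f \<in> extensional \<Omega>. integrable (lebesgue_on \<Omega>) f}"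

definition L1_norm :: "'a::euclidean_space set \<Rightarrow> ('a \<Rightarrow> real) \<Rightarrow> ennreal" where
  "L1_norm \<Omega> f = (\<integral>\<^sup>+ x. ennreal \<bar>f x\<bar> \<partial>lebesgue_on \<Omega>)"

definition L1_open :: "'a::euclidean_space set \<Rightarrow> ('a \<Rightarrow> real) set \<Rightarrow> bool" where
  "L1_open \<Omega> U \<longleftrightarrow> U \<subseteq> L1 \<Omega> \<and>
     (\<forall>f\<in>U. \<exists>e>0. \<forall>g\<in>L1 \<Omega>. L1_norm \<Omega> (\<lambda>x. g x - f x) < ennreal e \<longrightarrow> g \<in> U)"

text \<open>
  On representatives this topology is only given by a seminorm, so it is not Hausdorff.  A set of
  representatives is compact iff the corresponding set of classes is compact.
\<close>

definition L1_topology :: "'a::euclidean_space set \<Rightarrow> ('a \<Rightarrow> real) topology" where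
  "L1_topology \<Omega> = topology (L1_open \<Omega>)"

lemma istopology_L1_open: "istopology (L1_open \<Omega>)"
  unfolding istopology_def
proof (intro conjI allI impI)
  fix S T :: "('a \<Rightarrow> real) set"
  assume S: "L1_open \<Omega> S" and T: "L1_open \<Omega> T"
  show "L1_open \<Omega> (S \<inter> T)"
    unfolding L1_open_def
  proof (intro conjI ballI)
    show "S \<inter> T \<subseteq> L1 \<Omega>" using S by (auto simp: L1_open_def)
    fix f assume "f \<in> S \<inter> T"
    then obtain d e where
      "d > 0" "\<forall>g\<in>L1 \<Omega>. L1_norm \<Omega> (\<lambda>x. g x - f x) < ennreal d \<longrightarrow> g \<in> S"
      "e > 0" "\<forall>g\<in>L1 \<Omega>. L1_norm \<Omega> (\<lambda>x. g x - f x) < ennreal e \<longrightarrow> g \<in> T"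
      using S T unfolding L1_open_def by blast
    then show "\<exists>e>0. \<forall>g\<in>L1 \<Omega>. L1_norm \<Omega> (\<lambda>x. g x - f x) < ennreal e \<longrightarrow> g \<in> S \<inter> T"
      by (intro exI[of _ "min d e"]) (auto simp: min_def not_le split: if_splits dest: less_le_trans[OF _ ennreal_leI] less_le_trans[OF _ ennreal_leI[OF less_imp_le]])
  qed
next
  fix \<K> :: "('a \<Rightarrow> real) set set"
  assume "\<forall>S\<in>\<K>. L1_open \<Omega> S"
  then show "L1_open \<Omega> (\<Union>\<K>)"
    unfolding L1_open_def by (simp add: Union_iff) (meson Sup_least UnionE UnionI)
qed

lemma openin_L1_topology: "openin (L1_topology \<Omega>) = L1_open \<Omega>"
  by (simp add: L1_topology_def istopology_L1_open topology_inverse')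

lemma topspace_L1_topology: "topspace (L1_topology \<Omega>) = L1 \<Omega>"
proof
  show "topspace (L1_topology \<Omega>) \<subseteq> L1 \<Omega>"
    by (auto simp: topspace_def openin_L1_topology L1_open_def)
  have "L1_open \<Omega> (L1 \<Omega>)"
    by (auto simp: L1_open_def intro: exI[of _ 1])
  then show "L1 \<Omega> \<subseteq> topspace (L1_topology \<Omega>)"
    by (simp add: openin_L1_topology openin_subset)
qed


section \<open>Densities and conditioning\<close>

definition densities :: "('a::euclidean_space \<Rightarrow> real) set" where
  "densities = {f \<in> L1 UNIV. (AE z in lebesgue. 0 \<le> f z) \<and> (\<integral>z. f z \<partial>lebesgue) = 1}"

definition marginal :: "('a::euclidean_space \<times> 'b::euclidean_space \<Rightarrow> real) \<Rightarrow> 'b \<Rightarrow> real" where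
  "marginal f y = (\<integral>x. f (x, y) \<partial>lebesgue)"

text \<open>
  The limit inferior along the filter of almost everywhere true predicates, dual to
  \<open>esssup\<close> in \<open>HOL-Probability.Essential_Supremum\<close>.
\<close>

definition essinf :: "'a measure \<Rightarrow> ('a \<Rightarrow> real) \<Rightarrow> ereal" where
  "essinf M f = Liminf (ae_filter M) (\<lambda>x. ereal (f x))"

definition cond_domain ::
    "real \<Rightarrow> 'b::euclidean_space set \<Rightarrow> ('a::euclidean_space \<times> 'b \<Rightarrow> real) set" where
  "cond_domain \<delta> B = {f \<in> densities. ereal \<delta> \<le> essinf (lebesgue_on B) (marginal f)}"

definition kernel_conditioning ::
    "'b::euclidean_space set \<Rightarrow> ('a::euclidean_space \<times> 'b \<Rightarrow> real) \<Rightarrow> 'a \<times> 'b \<Rightarrow> real" where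
  "kernel_conditioning B \<rho> = (\<lambda>(x, y) \<in> UNIV \<times> B. \<rho> (x, y) / marginal \<rho> y)"


section \<open>Neural networks\<close>

definition relu :: "real \<Rightarrow> real" where
  "relu t = max 0 t"

definition nonlinearity :: "(real \<Rightarrow> real) \<Rightarrow> bool" where
  "nonlinearity \<sigma> \<longleftrightarrow> continuous_on UNIV \<sigma> \<and> \<not> (\<exists>a b. \<forall>t. \<sigma> t = a * t + b)"

text \<open>
  Since dimensions and widths are existentially quantified below, \<open>\<real>\<^sup>d\<close> is \<^term>\<open>carrier_vec d\<close>.
  The predicate \<open>neural_network \<alpha> p q N\<close> holds if \<open>N\<close> is a feedforward network
  \<open>\<real>\<^sup>p \<rightarrow> \<real>\<^sup>q\<close> with activation \<open>\<alpha>\<close> on its hidden layers and an affine output layer.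
\<close>

inductive neural_network ::
    "(real \<Rightarrow> real) \<Rightarrow> nat \<Rightarrow> nat \<Rightarrow> (real vec \<Rightarrow> real vec) \<Rightarrow> bool" for \<alpha> where
  affine: "W \<in> carrier_mat q p \<Longrightarrow> b \<in> carrier_vec q \<Longrightarrow>
    neural_network \<alpha> p q (\<lambda>v. W *\<^sub>v v + b)"
| hidden: "0 < k \<Longrightarrow> W \<in> carrier_mat k p \<Longrightarrow> b \<in> carrier_vec k \<Longrightarrow> neural_network \<alpha> k q N \<Longrightarrow>
    neural_network \<alpha> p q (\<lambda>v. N (map_vec \<alpha> (W *\<^sub>v v + b)))"

definition shallow_relu_network :: "(real \<Rightarrow> real) \<Rightarrow> bool" where
  "shallow_relu_network S \<longleftrightarrow>
     (\<exists>(k::nat) a w b c. \<forall>t. S t = c + (\<Sum>i<k. a i * relu (w i * t + b i)))"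

text \<open>
  Networks see points of the domain through a fixed enumeration of the standard basis.  The order
  is immaterial, since the first affine map of a network absorbs permutations of its inputs.
\<close>

definition basis_list :: "'a::euclidean_space list" where
  "basis_list = (SOME bs. set bs = Basis \<and> distinct bs)"

definition coords :: "'a::euclidean_space \<Rightarrow> real vec" where
  "coords x = vec DIM('a) (\<lambda>i. inner x (basis_list ! i))"

lemma basis_list:
  shows set_basis_list: "set (basis_list :: 'a::euclidean_space list) = Basis"
    and distinct_basis_list: "distinct (basis_list :: 'a list)"
    and length_basis_list: "length (basis_list :: 'a list) = DIM('a)"
proof -
  have "\<exists>bs :: 'a list. set bs = Basis \<and> distinct bs"
    by (rule finite_distinct_list) simp
  from someI_ex[OF this] show *: "set (basis_list :: 'a list) = Basis" "distinct (basis_list :: 'a list)"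
    by (simp_all add: basis_list_def)
  show "length (basis_list :: 'a list) = DIM('a)"
    using * by (metis distinct_card)
qed


section \<open>Neural operators\<close>

text \<open>
  These operators act on scalar functions, so the values \<open>f x\<close> of inputs are turned into
  one-dimensional vectors, and the scalar output is read off as component \<open>0\<close>.  The
  predicates below include the requirement that every layer is a well-defined map between the given
  collections of functions.
\<close>

definition lifting_layer ::
    "'a::euclidean_space set \<Rightarrow> nat \<Rightarrow> ('a \<Rightarrow> real vec) set \<Rightarrow>
     (('a \<Rightarrow> real) \<Rightarrow> 'a \<Rightarrow> real vec) \<Rightarrow> bool" where
  "lifting_layer \<Omega> d F \<R> \<longleftrightarrow>
     \<R> \<in> L1 \<Omega> \<rightarrow> F \<and>
     (\<exists>N. neural_network relu (DIM('a) + 1) d N \<and>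
        (\<forall>f\<in>L1 \<Omega>. \<R> f = (\<lambda>x\<in>\<Omega>. N (coords x @\<^sub>v vec 1 (\<lambda>_. f x)))))"

definition projection_layer ::
    "'a::euclidean_space set \<Rightarrow> nat \<Rightarrow> ('a \<Rightarrow> real vec) set \<Rightarrow>
     (('a \<Rightarrow> real vec) \<Rightarrow> 'a \<Rightarrow> real) \<Rightarrow> bool" where
  "projection_layer \<Omega> d F \<Q> \<longleftrightarrow>
     \<Q> \<in> F \<rightarrow> L1 \<Omega> \<and>
     (\<exists>N. neural_network relu (DIM('a) + d) 1 N \<and>
        (\<forall>f\<in>F. \<Q> f = (\<lambda>x\<in>\<Omega>. N (coords x @\<^sub>v f x) $ 0)))"

definition pairing ::
    "'a::euclidean_space set \<Rightarrow> ('a \<Rightarrow> real vec) \<Rightarrow> ('a \<Rightarrow> real vec) \<Rightarrow> real" where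
  "pairing \<Omega> u v = (\<integral>x. u x \<bullet> v x \<partial>lebesgue_on \<Omega>)"

definition hidden_layer ::
    "(real \<Rightarrow> real) \<Rightarrow> 'a::euclidean_space set \<Rightarrow> nat \<Rightarrow> nat \<Rightarrow>
     ('a \<Rightarrow> real vec) set \<Rightarrow> ('a \<Rightarrow> real vec) set \<Rightarrow>
     (('a \<Rightarrow> real vec) \<Rightarrow> 'a \<Rightarrow> real vec) \<Rightarrow> bool" where
  "hidden_layer \<sigma> \<Omega> p q F G \<L> \<longleftrightarrow>
     \<L> \<in> F \<rightarrow> G \<and>
     (\<exists>W b (M::nat) T \<psi> \<phi>.
        W \<in> carrier_mat q p \<and> b \<in> carrier_vec q \<and>
        (\<forall>j<M. T j \<in> carrier_mat q p \<and> \<psi> j \<in> \<Omega> \<rightarrow> carrier_vec q \<and> \<phi> j \<in> G \<and>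
           (\<forall>f\<in>F. integrable (lebesgue_on \<Omega>) (\<lambda>x. (T j *\<^sub>v f x) \<bullet> \<psi> j x))) \<and>
        (\<forall>f\<in>F. \<L> f = (\<lambda>x\<in>\<Omega>. map_vec \<sigma> (W *\<^sub>v f x + b +
           vec q (\<lambda>i. \<Sum>j<M. pairing \<Omega> (\<lambda>x'. T j *\<^sub>v f x') (\<psi> j) * \<phi> j x $ i)))))"

definition neural_operator ::
    "(real \<Rightarrow> real) \<Rightarrow> 'a::euclidean_space set \<Rightarrow> (('a \<Rightarrow> real) \<Rightarrow> 'a \<Rightarrow> real) \<Rightarrow> bool" where
  "neural_operator \<sigma> \<Omega> \<Psi> \<longleftrightarrow>
     (\<exists>L d F \<R> \<L> \<Q>.
        0 < L \<and>
        (\<forall>l\<le>L. 0 < d l \<and> F l \<subseteq> \<Omega> \<rightarrow>\<^sub>E carrier_vec (d l)) \<and>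
        lifting_layer \<Omega> (d 0) (F 0) \<R> \<and>
        (\<forall>l\<in>{1..L}. hidden_layer \<sigma> \<Omega> (d (l - 1)) (d l) (F (l - 1)) (F l) (\<L> l)) \<and>
        projection_layer \<Omega> (d L) (F L) \<Q> \<and>
        (\<forall>f\<in>L1 \<Omega>. \<Psi> f = \<Q> (fold \<L> [1..<Suc L] (\<R> f))))"

definition zero_extension :: "'a set \<Rightarrow> ('a \<Rightarrow> real) \<Rightarrow> 'a \<Rightarrow> real" where
  "zero_extension \<Omega> f = (\<lambda>x. if x \<in> \<Omega> then f x else 0)"

text \<open>The two truncation sets coincide and are both \<open>\<Omega>\<close>.\<close>

definition full_space_neural_operator ::
    "(real \<Rightarrow> real) \<Rightarrow> 'a::euclidean_space set \<Rightarrow> (('a \<Rightarrow> real) \<Rightarrow> 'a \<Rightarrow> real) \<Rightarrow> bool" where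
  "full_space_neural_operator \<sigma> \<Omega> \<Psi> \<longleftrightarrow>
     (\<exists>\<Psi>\<^sub>0 S. neural_operator \<sigma> \<Omega> \<Psi>\<^sub>0 \<and> shallow_relu_network S \<and>
        (\<forall>f\<in>L1 UNIV. (\<lambda>x\<in>\<Omega>. S (restrict f \<Omega> x)) \<in> L1 \<Omega> \<and>
           \<Psi> f = zero_extension \<Omega> (\<Psi>\<^sub>0 (\<lambda>x\<in>\<Omega>. S (restrict f \<Omega> x)))))"

definition open_cube :: "real \<Rightarrow> 'a::euclidean_space set" where
  "open_cube R = {x. \<forall>b\<in>Basis. - R < inner x b \<and> inner x b < R}"

end

theory Submission
  imports Defs
begin

text \<open>
  On densities whose marginal is at least \<open>\<delta>\<close> on \<open>B\<close>, conditioning is Lipschitz in \<open>L\<^sup>1\<close>.  It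
  therefore suffices to approximate the kernel of \<open>\<rho>\<close> by \<open>\<Sum>k. \<chi>\<^sub>k(\<rho>) g\<^sub>k\<close>, where \<open>\<chi>\<close> is a partition of unity
  on \<open>K\<close> into small pieces around points \<open>c\<^sub>k \<in> K\<close> and \<open>g\<^sub>k\<close> is a simple function of bounded
  support that is close to the kernel of \<open>c\<^sub>k\<close>.  One hidden layer produces the values
  \<open>\<sigma>(w \<integral>\<^sub>A \<rho> + b)\<close> and \<open>\<sigma>(w 1\<^sub>P(x) + b)\<close> for bounded measurable \<open>A\<close>, \<open>P\<close>.  Since \<open>\<sigma>\<close> is continuous
  and not constant, the former separate the points of \<open>K\<close> and the latter recover indicators, so
  that, by compactness, \<open>\<chi>\<close> can be computed from finitely many of them by the ReLU network of the
  projection layer, which also multiplies \<open>\<chi>\<^sub>k\<close> with the indicators that make up \<open>g\<^sub>k\<close>.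
\<close>

section \<open>Functions computed by ReLU networks\<close>

text \<open>An arbitrary continuous \<open>\<sigma>\<close> need not pass \<open>f x\<close> on to
  the next layer, so everything about \<open>\<rho>\<close> is routed through pairings with
  indicators of bounded sets, which are integrable against every \<open>L1\<close> function. What
  the projection network computes from given inputs is closed under \<open>+\<close>, scaling and
  \<open>max\<close>, but not under multiplication. This rules out dividing bumps by their sum: the
  partition of unity comes from the increments of a running maximum. It also restricts products to
  those with an indicator, and these demand \<open>0 \<le> \<chi> \<le> 1\<close> for every
  argument, not just on \<open>K\<close>. Truncation costs no accuracy: all supports and all pairing
  sets are bounded and fixed before the cube is chosen to contain them. The error
  \<open>\<epsilon>\<close> is split in half between the variation of the kernel over one piece,
  with Lipschitz constant \<open>4 / \<delta>\<close>, and the approximation of the kernel at the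
  centre of the piece.\<close>

inductive_set affine_span :: "('x \<Rightarrow> real) set \<Rightarrow> ('x \<Rightarrow> real) set" for F where
  const: "(\<lambda>_. c) \<in> affine_span F"
| base: "f \<in> F \<Longrightarrow> f \<in> affine_span F"
| add: "u \<in> affine_span F \<Longrightarrow> v \<in> affine_span F \<Longrightarrow> (\<lambda>x. u x + v x) \<in> affine_span F"
| scale: "u \<in> affine_span F \<Longrightarrow> (\<lambda>x. c * u x) \<in> affine_span F"

text \<open>Depth and width are forgotten here, so that closure properties are immediate;
  \<open>relu_class\<close> restores them when an actual network is needed. The generators are
  functions on an arbitrary type, later that of the pairs \<open>(f, x)\<close>, so that neurons can
  serve as network inputs.\<close>

inductive_set relu_hull :: "('x \<Rightarrow> real) set \<Rightarrow> ('x \<Rightarrow> real) set" for F where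
  const: "(\<lambda>_. c) \<in> relu_hull F"
| base: "f \<in> F \<Longrightarrow> f \<in> relu_hull F"
| add: "u \<in> relu_hull F \<Longrightarrow> v \<in> relu_hull F \<Longrightarrow> (\<lambda>x. u x + v x) \<in> relu_hull F"
| scale: "u \<in> relu_hull F \<Longrightarrow> (\<lambda>x. c * u x) \<in> relu_hull F"
| relu: "u \<in> relu_hull F \<Longrightarrow> (\<lambda>x. relu (u x)) \<in> relu_hull F"

lemma affine_span_mono: "F \<subseteq> affine_span G \<Longrightarrow> affine_span F \<subseteq> affine_span G"
proof
  fix u assume "F \<subseteq> affine_span G" "u \<in> affine_span F"
  then show "u \<in> affine_span G"
    by (induction rule: affine_span.induct[consumes 1, OF \<open>u \<in> affine_span F\<close>])
       (auto intro: affine_span.intros)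
qed

lemma affine_span_list:
  assumes "u \<in> affine_span (set fs)"
  shows "\<exists>a c. \<forall>x. u x = c + (\<Sum>i<length fs. a i * (fs ! i) x)"
  using assms
proof induction
  case (const c)
  then show ?case by (intro exI[of _ "\<lambda>_. 0"] exI[of _ c]) auto
next
  case (base f)
  then obtain j where "j < length fs" "fs ! j = f" by (auto simp: in_set_conv_nth)
  then have "f x = 0 + (\<Sum>i<length fs. (if i = j then 1 else 0) * (fs ! i) x)" for x
    by (subst sum.cong[OF refl, of _ _ "\<lambda>i. if i = j then (fs ! i) x else 0"]) auto
  then show ?case by (intro exI[of _ "\<lambda>i. if i = j then 1 else 0"] exI[of _ 0]) blast
next
  case (add u v)
  then obtain a c b d where "\<forall>x. u x = c + (\<Sum>i<length fs. a i * (fs ! i) x)"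
    "\<forall>x. v x = d + (\<Sum>i<length fs. b i * (fs ! i) x)" by blast
  then show ?case
    by (intro exI[of _ "\<lambda>i. a i + b i"] exI[of _ "c + d"]) (auto simp: algebra_simps sum.distrib)
next
  case (scale u k)
  then obtain a c where "\<forall>x. u x = c + (\<Sum>i<length fs. a i * (fs ! i) x)" by blast
  then show ?case
    by (intro exI[of _ "\<lambda>i. k * a i"] exI[of _ "k * c"]) (auto simp: algebra_simps sum_distrib_left)
qed

text \<open>
  The recursion peels off the input layer, as \<^const>\<open>neural_network\<close> does; \<open>F'\<close> are the neurons
  of that layer.
\<close>

fun relu_class :: "nat \<Rightarrow> ('x \<Rightarrow> real) set \<Rightarrow> ('x \<Rightarrow> real) set" where
  "relu_class 0 F = affine_span F"
| "relu_class (Suc n) F =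
    {u. \<exists>F'. finite F' \<and> F' \<noteq> {} \<and> F' \<subseteq> (\<lambda>w x. relu (w x)) ` affine_span F \<and> u \<in> relu_class n F'}"

lemma relu_class_mono: "F \<subseteq> affine_span G \<Longrightarrow> relu_class n F \<subseteq> relu_class n G"
proof (induction n)
  case 0
  then show ?case by (simp add: affine_span_mono)
next
  case (Suc n)
  have "(\<lambda>w x. relu (w x)) ` affine_span F \<subseteq> (\<lambda>w x. relu (w x)) ` affine_span G"
    by (intro image_mono affine_span_mono Suc.prems)
  then show ?case
    unfolding relu_class.simps by (intro Collect_mono ex_mono conj_mono impI) (auto elim: order_trans)
qed

lemma relu_class_mono': "F \<subseteq> G \<Longrightarrow> u \<in> relu_class n F \<Longrightarrow> u \<in> relu_class n G"
  by (rule subsetD[OF relu_class_mono]) (auto intro: affine_span.base)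

lemma relu_class_const: "(\<lambda>_. c) \<in> relu_class n F"
proof (induction n arbitrary: F)
  case (Suc n)
  \<comment> \<open>A dummy neuron: the first layer must not be empty, since \<open>hidden\<close>
    asks for \<open>0 < k\<close>.\<close>
  have "(\<lambda>_. relu 0) \<in> (\<lambda>w x. relu (w x)) ` affine_span F"
    by (rule image_eqI[OF _ affine_span.const[of 0]]) auto
  with Suc[of "{\<lambda>_. relu 0}"] show ?case
    by (auto intro!: exI[of _ "{\<lambda>_. relu 0}"])
qed (auto intro: affine_span.const)

lemma relu_class_scale: "u \<in> relu_class n F \<Longrightarrow> (\<lambda>x. c * u x) \<in> relu_class n F"
proof (induction n arbitrary: F)
  case (Suc n)
  then obtain F' where F: "finite F'" "F' \<noteq> {}" "F' \<subseteq> (\<lambda>w x. relu (w x)) ` affine_span F" "u \<in> relu_class n F'"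
    by auto
  from Suc.IH[OF this(4)] F(1-3) show ?case unfolding relu_class.simps(2) by blast
qed (simp add: affine_span.scale)

text \<open>Two networks of equal depth run side by side: the union of their input layers feeds both
  remainders.\<close>

lemma relu_class_add:
  "u \<in> relu_class n F \<Longrightarrow> v \<in> relu_class n F \<Longrightarrow> (\<lambda>x. u x + v x) \<in> relu_class n F"
proof (induction n arbitrary: F)
  case (Suc n)
  then obtain F1 F2 where F: "finite F1" "F1 \<noteq> {}" "F1 \<subseteq> (\<lambda>w x. relu (w x)) ` affine_span F" "u \<in> relu_class n F1"
    "finite F2" "F2 \<subseteq> (\<lambda>w x. relu (w x)) ` affine_span F" "v \<in> relu_class n F2"
    by auto
  have "u \<in> relu_class n (F1 \<union> F2)" "v \<in> relu_class n (F1 \<union> F2)"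
    using relu_class_mono'[OF _ F(4)] relu_class_mono'[OF _ F(7)] by blast+
  from Suc.IH[OF this] F show ?case
    by (auto intro!: exI[of _ "F1 \<union> F2"])
qed (auto intro: affine_span.add)

text \<open>The new activation sits at the output end, whereas the recursion adds layers at the
  input end; the induction moves it past the input layers.\<close>

lemma relu_class_relu: "u \<in> relu_class n F \<Longrightarrow> (\<lambda>x. relu (u x)) \<in> relu_class (Suc n) F"
proof (induction n arbitrary: F)
  case 0
  then show ?case
    by (auto intro!: exI[of _ "{\<lambda>x. relu (u x)}"] intro: affine_span.base)
next
  case (Suc n)
  then obtain F' where F: "finite F'" "F' \<noteq> {}" "F' \<subseteq> (\<lambda>w x. relu (w x)) ` affine_span F" "u \<in> relu_class n F'"
    by auto
  from Suc.IH[OF this(4)] F(1-3) show ?case unfolding relu_class.simps(2)[of "Suc n"] by blast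
qed

text \<open>Networks can be deepened since \<open>t = relu t - relu (- t)\<close>.\<close>

lemma relu_class_Suc: "u \<in> relu_class n F \<Longrightarrow> u \<in> relu_class (Suc n) F"
proof -
  assume u: "u \<in> relu_class n F"
  have "(\<lambda>x. relu (u x) + - 1 * relu (- 1 * u x)) \<in> relu_class (Suc n) F"
    by (intro relu_class_add relu_class_scale relu_class_relu u)
  also have "(\<lambda>x. relu (u x) + - 1 * relu (- 1 * u x)) = u"
    by (auto simp: relu_def fun_eq_iff max_def)
  finally show ?thesis .
qed

lemma relu_class_mono_depth: "n \<le> m \<Longrightarrow> u \<in> relu_class n F \<Longrightarrow> u \<in> relu_class m F"
  by (induction m rule: dec_induct) (auto simp: relu_class_Suc simp del: relu_class.simps)

text \<open>A derivation mentions only finitely many generators. In a sum the shallower summand is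
  deepened to \<open>max n m\<close>, because only equal depths can be added.\<close>

lemma relu_hull_class:
  assumes "u \<in> relu_hull F"
  shows "\<exists>n F0. finite F0 \<and> F0 \<subseteq> F \<and> u \<in> relu_class n F0"
  using assms
proof induction
  case (const c)
  then show ?case by (blast intro: relu_class_const)
next
  case (base f)
  then show ?case by (intro exI[of _ 0] exI[of _ "{f}"]) (auto intro: affine_span.base)
next
  case (add u v)
  then obtain n F1 m F2 where F: "finite F1" "F1 \<subseteq> F" "u \<in> relu_class n F1"
    "finite F2" "F2 \<subseteq> F" "v \<in> relu_class m F2" by blast
  have "u \<in> relu_class (max n m) (F1 \<union> F2)" "v \<in> relu_class (max n m) (F1 \<union> F2)"
    using F by (auto intro: relu_class_mono' relu_class_mono_depth[of n] relu_class_mono_depth[of m]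
      simp del: relu_class.simps)
  with F show ?case
    by (intro exI[of _ "max n m"] exI[of _ "F1 \<union> F2"]) (auto intro: relu_class_add simp del: relu_class.simps)
next
  case (scale u c)
  then show ?case by (blast intro: relu_class_scale)
next
  case (relu u)
  then show ?case by (blast intro: relu_class_relu)
qed

text \<open>The list fixes an order of the inputs and may contain repetitions. In each recursion
  step the finite set of neurons is listed in turn and becomes the input of the remaining
  network.\<close>

lemma relu_class_network:
  assumes "u \<in> relu_class n (set fs)"
  shows "\<exists>N. neural_network relu (length fs) 1 N \<and>
    (\<forall>x. N (vec (length fs) (\<lambda>i. (fs ! i) x)) = vec 1 (\<lambda>_. u x))"
  using assms
proof (induction n arbitrary: fs)
  case 0
  then obtain a c where ac: "\<And>x. u x = c + (\<Sum>i<length fs. a i * (fs ! i) x)"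
    using affine_span_list by fastforce
  let ?W = "mat 1 (length fs) (\<lambda>(_, i). a i)" and ?b = "vec 1 (\<lambda>_. c)"
  have "neural_network relu (length fs) 1 (\<lambda>v. ?W *\<^sub>v v + ?b)"
    by (rule neural_network.affine) auto
  moreover have "?W *\<^sub>v vec (length fs) (\<lambda>i. (fs ! i) x) + ?b = vec 1 (\<lambda>_. u x)" for x
    by (intro eq_vecI) (simp_all add: ac scalar_prod_def lessThan_atLeast0)
  ultimately show ?case by blast
next
  case (Suc n)
  then obtain F' where F': "finite F'" "F' \<noteq> {}" "F' \<subseteq> (\<lambda>w x. relu (w x)) ` affine_span (set fs)" "u \<in> relu_class n F'"
    by auto
  obtain gs where gs: "set gs = F'" using finite_list[OF F'(1)] by blast
  obtain N where N: "neural_network relu (length gs) 1 N"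
    "\<And>x. N (vec (length gs) (\<lambda>i. (gs ! i) x)) = vec 1 (\<lambda>_. u x)"
    using Suc.IH[of gs] F'(4) gs by blast
  have "\<forall>i\<in>{..<length gs}. \<exists>a c. \<forall>x. (gs ! i) x = relu (c + (\<Sum>j<length fs. a j * (fs ! j) x))"
  proof
    fix i assume "i \<in> {..<length gs}"
    then obtain w where w: "w \<in> affine_span (set fs)" "gs ! i = (\<lambda>x. relu (w x))"
      using F'(3) gs nth_mem[of i gs] by auto
    from affine_span_list[OF w(1)] obtain a c where
      "\<forall>x. w x = c + (\<Sum>i<length fs. a i * (fs ! i) x)" by blast
    with w(2) show "\<exists>a c. \<forall>x. (gs ! i) x = relu (c + (\<Sum>j<length fs. a j * (fs ! j) x))" by auto
  qed
  then obtain a c where ac: "\<And>i x. i < length gs \<Longrightarrow> (gs ! i) x = relu (c i + (\<Sum>j<length fs. a i j * (fs ! j) x))"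
    by (auto simp: bchoice_iff)
  let ?W = "mat (length gs) (length fs) (\<lambda>(i, j). a i j)" and ?b = "vec (length gs) c"
  have "neural_network relu (length fs) 1 (\<lambda>v. N (map_vec relu (?W *\<^sub>v v + ?b)))"
    by (rule neural_network.hidden[OF _ _ _ N(1)]) (use gs F'(2) in auto)
  moreover have "map_vec relu (?W *\<^sub>v vec (length fs) (\<lambda>i. (fs ! i) x) + ?b) = vec (length gs) (\<lambda>i. (gs ! i) x)" for x
    by (intro eq_vecI) (simp_all add: ac scalar_prod_def lessThan_atLeast0 add.commute)
  ultimately show ?case using N(2) by (intro exI conjI) (assumption, simp)
qed

text \<open>Quantifying over all longer lists \<open>gs\<close> lets further inputs be inserted
  later, such as the coordinates of the point and a dummy neuron.\<close>

lemma relu_hull_network: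
  assumes "u \<in> relu_hull F"
  obtains fs where "set fs \<subseteq> F"
    and "\<And>gs. set fs \<subseteq> set gs \<Longrightarrow> \<exists>N. neural_network relu (length gs) 1 N \<and>
      (\<forall>x. N (vec (length gs) (\<lambda>i. (gs ! i) x)) = vec 1 (\<lambda>_. u x))"
  using relu_hull_class[OF assms] finite_list relu_class_network relu_class_mono'
  by metis

section \<open>Boundedness and measurability of network outputs\<close>

text \<open>Affine maps and \<open>relu\<close> preserve both properties in every component. This is
  what makes the projection layer end in \<open>L1\<close>: a bounded measurable function is
  integrable on a bounded domain.\<close>

lemma neural_network_bounded_measurable:
  assumes "neural_network relu p q N"
    and "\<And>x. x \<in> space M \<Longrightarrow> u x \<in> carrier_vec p"
    and "\<And>i. i < p \<Longrightarrow> (\<lambda>x. u x $ i) \<in> borel_measurable M"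
    and "\<And>i. i < p \<Longrightarrow> bounded ((\<lambda>x. u x $ i) ` space M)"
    and "j < q"
  shows "(\<lambda>x. N (u x) $ j) \<in> borel_measurable M \<and> bounded ((\<lambda>x. N (u x) $ j) ` space M)"
proof -
  have aff: "(\<lambda>x. (W *\<^sub>v u x + b) $ j) \<in> borel_measurable M \<and> bounded ((\<lambda>x. (W *\<^sub>v u x + b) $ j) ` space M)"
    if "W \<in> carrier_mat q p" "b \<in> carrier_vec q" "j < q"
      and u: "\<And>x. x \<in> space M \<Longrightarrow> u x \<in> carrier_vec p"
        "\<And>i. i < p \<Longrightarrow> (\<lambda>x. u x $ i) \<in> borel_measurable M"
        "\<And>i. i < p \<Longrightarrow> bounded ((\<lambda>x. u x $ i) ` space M)"
    for W b q p and u :: "_ \<Rightarrow> real vec" and j :: nat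
  proof -
    have eq: "(W *\<^sub>v u x + b) $ j = (\<Sum>i<p. W $$ (j, i) * u x $ i) + b $ j" if "x \<in> space M" for x
      using \<open>W \<in> _\<close> \<open>b \<in> _\<close> \<open>j < q\<close> u(1)[OF that] by (auto simp: scalar_prod_def lessThan_atLeast0)
    have "\<exists>C. \<forall>i<p. \<forall>x\<in>space M. \<bar>u x $ i\<bar> \<le> C i"
      using u(3) unfolding bounded_real by (intro choice) fastforce
    then obtain C where C: "\<And>i x. i < p \<Longrightarrow> x \<in> space M \<Longrightarrow> \<bar>u x $ i\<bar> \<le> C i" by blast
    have "\<bar>(\<Sum>i<p. W $$ (j, i) * u x $ i) + b $ j\<bar> \<le> (\<Sum>i<p. \<bar>W $$ (j, i)\<bar> * C i) + \<bar>b $ j\<bar>"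
      if "x \<in> space M" for x
    proof -
      have "\<bar>\<Sum>i<p. W $$ (j, i) * u x $ i\<bar> \<le> (\<Sum>i<p. \<bar>W $$ (j, i)\<bar> * C i)"
        by (rule order_trans[OF sum_abs]) (auto intro!: sum_mono simp: abs_mult mult_left_mono C that)
      then show ?thesis by linarith
    qed
    then have "bounded ((\<lambda>x. (W *\<^sub>v u x + b) $ j) ` space M)"
      unfolding bounded_real using eq by auto
    moreover have "(\<lambda>x. (\<Sum>i<p. W $$ (j, i) * u x $ i) + b $ j) \<in> borel_measurable M"
      using u(2) by auto
    ultimately show ?thesis using measurable_cong[of M, OF eq] by auto
  qed
  show ?thesis
    using assms
  proof (induction arbitrary: u j rule: neural_network.induct)
    case (affine W q p b)
    then show ?case by (intro aff) auto
  next
    case (hidden k W p b q N)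
    note affk = aff[OF hidden.hyps(2,3) _ hidden.prems(1-3)]
    show ?case
    proof (rule hidden.IH[OF _ _ _ hidden.prems(4)])
      fix i assume i: "i < k"
      have eq: "map_vec relu (W *\<^sub>v u x + b) $ i = relu ((W *\<^sub>v u x + b) $ i)" for x
        using hidden.hyps i by simp
      show "(\<lambda>x. map_vec relu (W *\<^sub>v u x + b) $ i) \<in> borel_measurable M"
        unfolding eq relu_def by (intro borel_measurable_max borel_measurable_const conjunct1[OF affk[OF i]])
      obtain C where "\<And>x. x \<in> space M \<Longrightarrow> \<bar>(W *\<^sub>v u x + b) $ i\<bar> \<le> C"
        using affk[OF i] by (auto simp: bounded_real)
      then show "bounded ((\<lambda>x. map_vec relu (W *\<^sub>v u x + b) $ i) ` space M)"
        unfolding eq bounded_real by (auto simp: relu_def max_def intro!: exI[of _ "\<bar>C\<bar>"]) force+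
    next
      show "map_vec relu (W *\<^sub>v u x + b) \<in> carrier_vec k" if "x \<in> space M" for x
        using hidden that by auto
    qed
  qed
qed


section \<open>Operators with one hidden layer\<close>

text \<open>
  The second lifted component is constant, so that pairings also produce constants and a hidden
  layer can evaluate arbitrary measurable sets at the point \<open>x\<close>.
\<close>

definition lifted :: "'a set \<Rightarrow> ('a \<Rightarrow> real) \<Rightarrow> 'a \<Rightarrow> real vec" where
  "lifted \<Omega> f = (\<lambda>x\<in>\<Omega>. vec 2 (\<lambda>i. if i = 0 then f x else 1))"

text \<open>Plays the role of the function space after the hidden layer: large enough for the
  decoding functions and for all layer outputs, small enough that any projection network maps it
  into \<open>L1\<close> of a bounded domain.\<close>

definition bounded_fields :: "'a::euclidean_space set \<Rightarrow> nat \<Rightarrow> ('a \<Rightarrow> real vec) set" where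
  "bounded_fields \<Omega> q = {g \<in> \<Omega> \<rightarrow>\<^sub>E carrier_vec q. \<forall>i<q.
     (\<lambda>x. g x $ i) \<in> borel_measurable (lebesgue_on \<Omega>) \<and> bounded ((\<lambda>x. g x $ i) ` \<Omega>)}"

text \<open>The flag says which lifted component is paired with the indicator of \<open>A\<close>:
  the function itself, or the constant \<open>1\<close>, which for bounded measurable
  \<open>A\<close> yields the measure of \<open>A\<close>.\<close>

definition moment :: "bool \<Rightarrow> 'a::euclidean_space set \<Rightarrow> ('a \<Rightarrow> real) \<Rightarrow> real" where
  "moment s A f = (\<integral>x. indicator A x * (if s then f x else 1) \<partial>lebesgue)"

text \<open>One component of a hidden layer whose encoding function is the indicator of
  \<open>A\<close> and whose decoding function is \<open>w\<close> times that of \<open>P\<close>.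
  With \<open>P = UNIV\<close> it depends on \<open>f\<close> only, with \<open>s = False\<close> on
  \<open>x\<close> only.\<close>

definition neuron ::
  "(real \<Rightarrow> real) \<Rightarrow> bool \<Rightarrow> 'a::euclidean_space set \<Rightarrow> 'a set \<Rightarrow> real \<Rightarrow> real \<Rightarrow> ('a \<Rightarrow> real) \<times> 'a \<Rightarrow> real" where
  "neuron \<sigma> s A P w b = (\<lambda>(f, x). \<sigma> (moment s A f * (w * indicator P x) + b))"

definition neurons :: "(real \<Rightarrow> real) \<Rightarrow> (('a::euclidean_space \<Rightarrow> real) \<times> 'a \<Rightarrow> real) set" where
  "neurons \<sigma> = {neuron \<sigma> s A P w b |s A P w b. bounded A \<and> A \<in> sets lebesgue \<and> P \<in> sets lebesgue}"

lemma coords_carrier [simp]: "coords (x :: 'a::euclidean_space) \<in> carrier_vec DIM('a)"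
  by (simp add: coords_def)

lemma lifting_layer_lifted:
  fixes \<Omega> :: "'a::euclidean_space set"
  shows "lifting_layer \<Omega> 2 (lifted \<Omega> ` L1 \<Omega>) (lifted \<Omega>)"
  unfolding lifting_layer_def
proof (intro conjI exI ballI)
  \<comment> \<open>Row \<open>0\<close> reads off the last input coordinate, which holds
    \<open>f x\<close>; row \<open>1\<close> vanishes, so that the bias supplies the constant
    \<open>1\<close>.\<close>
  let ?W = "mat 2 (DIM('a) + 1) (\<lambda>(i, j). if i = 0 \<and> j = DIM('a) then 1 else 0) :: real mat"
  let ?b = "vec 2 (\<lambda>i. if i = 0 then 0 else 1) :: real vec"
  show "neural_network relu (DIM('a) + 1) 2 (\<lambda>v. ?W *\<^sub>v v + ?b)"
    by (rule neural_network.affine) auto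
  fix f assume "f \<in> L1 \<Omega>"
  have "?W *\<^sub>v (coords x @\<^sub>v vec 1 (\<lambda>_. f x)) + ?b = vec 2 (\<lambda>i. if i = 0 then f x else 1)" for x
  proof (intro eq_vecI)
    fix i assume "i < dim_vec (vec 2 (\<lambda>i. if i = 0 then f x else 1) :: real vec)"
    then have i: "i < 2" by simp
    have "(?W *\<^sub>v (coords x @\<^sub>v vec 1 (\<lambda>_. f x))) $ i =
        (\<Sum>j\<in>{0..<DIM('a) + 1}. if j = DIM('a) then (if i = 0 then f x else 0) else 0)"
      using i by (auto simp: scalar_prod_def coords_def intro!: sum.cong)
    also have "\<dots> = (if i = 0 then f x else 0)" by (simp add: sum.delta)
    finally show "(?W *\<^sub>v (coords x @\<^sub>v vec 1 (\<lambda>_. f x)) + ?b) $ i = vec 2 (\<lambda>i. if i = 0 then f x else 1) $ i"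
      using i by simp
  qed auto
  then show "lifted \<Omega> f = (\<lambda>x\<in>\<Omega>. ?W *\<^sub>v (coords x @\<^sub>v vec 1 (\<lambda>_. f x)) + ?b)"
    by (auto simp: lifted_def)
qed auto

text \<open>On a bounded domain the coordinates of the points are bounded as well, so every input of
  the network is bounded and measurable.\<close>

lemma projection_layer_network:
  fixes \<Omega> :: "'a::euclidean_space set"
  assumes N: "neural_network relu (DIM('a) + q) 1 N" and \<Omega>: "bounded \<Omega>" "\<Omega> \<in> sets lebesgue"
  shows "projection_layer \<Omega> q (bounded_fields \<Omega> q) (\<lambda>g. \<lambda>x\<in>\<Omega>. N (coords x @\<^sub>v g x) $ 0)"
  unfolding projection_layer_def
proof (intro conjI exI ballI funcsetI)
  fix g :: "'a \<Rightarrow> real vec" assume g: "g \<in> bounded_fields \<Omega> q"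
  have comp: "(coords x @\<^sub>v g x) $ i = (if i < DIM('a) then inner x (basis_list ! i) else g x $ (i - DIM('a)))"
    if "i < DIM('a) + q" "x \<in> \<Omega>" for x i
  proof -
    have "dim_vec (g x) = q" using g that(2) carrier_vecD unfolding bounded_fields_def by blast
    with that(1) show ?thesis by (simp add: coords_def)
  qed
  have "(\<lambda>x. N (coords x @\<^sub>v g x) $ 0) \<in> borel_measurable (lebesgue_on \<Omega>) \<and>
    bounded ((\<lambda>x. N (coords x @\<^sub>v g x) $ 0) ` space (lebesgue_on \<Omega>))"
  proof (rule neural_network_bounded_measurable[OF N])
    show "coords x @\<^sub>v g x \<in> carrier_vec (DIM('a) + q)" if "x \<in> space (lebesgue_on \<Omega>)" for x
      using that g by (auto simp: bounded_fields_def)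
    fix i assume i: "i < DIM('a) + q"
    have "(\<lambda>x. if i < DIM('a) then inner x (basis_list ! i) else g x $ (i - DIM('a)))
        \<in> borel_measurable (lebesgue_on \<Omega>)"
      using g i by (cases "i < DIM('a)") (auto simp: bounded_fields_def intro!: measurable_restrict_space1 measurable_completion)
    then show "(\<lambda>x. (coords x @\<^sub>v g x) $ i) \<in> borel_measurable (lebesgue_on \<Omega>)"
      by (subst measurable_cong[OF comp]) (use i in auto)
    have "bounded ((\<lambda>x. if i < DIM('a) then inner x (basis_list ! i) else g x $ (i - DIM('a))) ` \<Omega>)"
    proof (cases "i < DIM('a)")
      case True
      then show ?thesis using bounded_linear_image[OF \<Omega>(1) bounded_linear_inner_left] by simp
    qed (use g i in \<open>auto simp: bounded_fields_def\<close>)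
    moreover have "(\<lambda>x. (coords x @\<^sub>v g x) $ i) ` space (lebesgue_on \<Omega>) =
        (\<lambda>x. if i < DIM('a) then inner x (basis_list ! i) else g x $ (i - DIM('a))) ` \<Omega>"
      using comp i by (intro image_cong) auto
    ultimately show "bounded ((\<lambda>x. (coords x @\<^sub>v g x) $ i) ` space (lebesgue_on \<Omega>))" by simp
  qed simp
  then obtain C where C: "(\<lambda>x. N (coords x @\<^sub>v g x) $ 0) \<in> borel_measurable (lebesgue_on \<Omega>)"
    "\<And>x. x \<in> \<Omega> \<Longrightarrow> \<bar>N (coords x @\<^sub>v g x) $ 0\<bar> \<le> C"
    by (auto simp: bounded_real)
  have fin: "finite_measure (lebesgue_on \<Omega>)"
    using \<Omega> by (intro finite_measure_lebesgue_on bounded_set_imp_lmeasurable)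
  have "integrable (lebesgue_on \<Omega>) (\<lambda>x. N (coords x @\<^sub>v g x) $ 0)"
    by (rule finite_measure.integrable_const_bound[OF fin _ C(1), where B = C]) (use C(2) in auto)
  then have "integrable (lebesgue_on \<Omega>) (\<lambda>x\<in>\<Omega>. N (coords x @\<^sub>v g x) $ 0)"
    by (subst Bochner_Integration.integrable_cong[OF refl, where g = "\<lambda>x. N (coords x @\<^sub>v g x) $ 0"]) auto
  then show "(\<lambda>x\<in>\<Omega>. N (coords x @\<^sub>v g x) $ 0) \<in> L1 \<Omega>"
    by (auto simp: L1_def)
qed (use N in auto)

section \<open>Cubes as truncation sets\<close>

lemma mem_open_cube: "x \<in> open_cube R \<longleftrightarrow> (\<forall>b\<in>Basis. \<bar>inner x b\<bar> < R)"
  by (auto simp: open_cube_def abs_less_iff)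

lemma open_cube_eq_box: "open_cube R = box (- R *\<^sub>R One) (R *\<^sub>R One)"
  by (auto simp: open_cube_def mem_box)

lemma bounded_open_cube: "bounded (open_cube R)"
  by (simp add: open_cube_eq_box)

lemma sets_open_cube: "open_cube R \<in> sets lebesgue"
  by (simp add: open_cube_eq_box)

lemma bounded_subset_open_cube:
  assumes "bounded A"
  obtains R where "R > 0" "A \<subseteq> open_cube R"
proof -
  obtain C where C: "\<And>x. x \<in> A \<Longrightarrow> norm x \<le> C" using assms by (auto simp: bounded_iff)
  have "\<bar>inner x b\<bar> < \<bar>C\<bar> + 1" if "x \<in> A" "b \<in> Basis" for x b
    using C[OF that(1)] Basis_le_norm[OF that(2), of x] by linarith
  then show ?thesis by (intro that[of "\<bar>C\<bar> + 1"]) (auto simp: mem_open_cube)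
qed

text \<open>With \<open>W = 0\<close> and \<open>M = q\<close>, the term with index \<open>j\<close>
  feeds component \<open>j\<close> alone: \<open>T j\<close>, \<open>\<psi> j\<close> and
  \<open>\<phi> j\<close> are supported on that row. Since \<open>A j \<subseteq> \<Omega>\<close>,
  pairing over \<open>\<Omega>\<close> agrees with the moment over the whole space, so the neurons
  are independent of the truncation.\<close>

lemma hidden_layer_neurons:
  fixes \<Omega> :: "'a::euclidean_space set"
  assumes \<sigma>: "continuous_on UNIV \<sigma>" and \<Omega>: "bounded \<Omega>" "\<Omega> \<in> sets lebesgue"
    and A: "\<And>i. i < q \<Longrightarrow> A i \<in> sets lebesgue \<and> A i \<subseteq> \<Omega>"
    and P: "\<And>i. i < q \<Longrightarrow> P i \<in> sets lebesgue"
  obtains \<L> where "hidden_layer \<sigma> \<Omega> 2 q (lifted \<Omega> ` L1 \<Omega>) (bounded_fields \<Omega> q) \<L>"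
    and "\<And>f x. f \<in> L1 UNIV \<Longrightarrow> x \<in> \<Omega> \<Longrightarrow>
      \<L> (lifted \<Omega> (restrict f \<Omega>)) x = vec q (\<lambda>i. neuron \<sigma> (s i) (A i) (P i) (w i) (b i) (f, x))"
proof -
  let ?T = "\<lambda>j. mat q 2 (\<lambda>(i, k). if i = j \<and> k = (if s j then 0 else 1) then 1 else 0) :: real mat"
  let ?\<psi> = "\<lambda>j x. vec q (\<lambda>i. if i = j then indicator (A j) x else 0) :: real vec"
  let ?\<phi> = "\<lambda>j. \<lambda>x\<in>\<Omega>. vec q (\<lambda>i. if i = j then w j * indicator (P j) x else 0) :: real vec"
  let ?c = "\<lambda>j g. pairing \<Omega> (\<lambda>x. ?T j *\<^sub>v g x) (?\<psi> j)"
  define \<L> where "\<L> g = (\<lambda>x\<in>\<Omega>. vec q (\<lambda>i. \<sigma> (?c i g * (w i * indicator (P i) x) + b i)))" for g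
  have meas_P: "(\<lambda>x. indicator (P i) x :: real) \<in> borel_measurable (lebesgue_on \<Omega>)" if "i < q" for i
    using P[OF that] by (intro measurable_restrict_space1) auto
  have scal: "(?T j *\<^sub>v lifted \<Omega> f x) \<bullet> ?\<psi> j x = indicator (A j) x * (if s j then f x else 1)"
    if "j < q" "x \<in> \<Omega>" for j x f
  proof -
    have "(?T j *\<^sub>v lifted \<Omega> f x) \<bullet> ?\<psi> j x =
        (\<Sum>i\<in>{0..<q}. if i = j then indicator (A j) x * (if s j then f x else 1) else 0)"
      unfolding scalar_prod_def using that
      by (intro sum.cong) (auto simp: scalar_prod_def lifted_def numeral_2_eq_2)
    also have "\<dots> = indicator (A j) x * (if s j then f x else 1)" using that by simp
    finally show ?thesis .
  qed
  have int1: "integrable (lebesgue_on \<Omega>) (\<lambda>x. indicator (A j) x * (if s j then f x else 1) :: real)"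
    if "j < q" "f \<in> L1 \<Omega>" for j f
  proof -
    have fin: "finite_measure (lebesgue_on \<Omega>)"
      using \<Omega> by (intro finite_measure_lebesgue_on bounded_set_imp_lmeasurable)
    have "integrable (lebesgue_on \<Omega>) (\<lambda>x. if s j then f x else 1)"
      using that finite_measure.integrable_const[OF fin] by (cases "s j") (auto simp: L1_def)
    moreover have "A j \<in> sets (lebesgue_on \<Omega>)"
      using A[OF that(1)] \<Omega> by (auto simp: sets_restrict_space_iff)
    ultimately show ?thesis
      using integrable_mult_indicator[of "A j" "lebesgue_on \<Omega>" "\<lambda>x. if s j then f x else 1"] by simp
  qed
  have int: "integrable (lebesgue_on \<Omega>) (\<lambda>x. (?T j *\<^sub>v lifted \<Omega> f x) \<bullet> ?\<psi> j x)"
    if "j < q" "f \<in> L1 \<Omega>" for j f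
    using int1[OF that]
    by (subst Bochner_Integration.integrable_cong[OF refl scal[OF that(1)]]) auto
  have moment: "?c j (lifted \<Omega> (restrict f \<Omega>)) = moment (s j) (A j) f" if "j < q" for j f
  proof -
    have "?c j (lifted \<Omega> (restrict f \<Omega>)) =
        (\<integral>x. indicator (A j) x * (if s j then restrict f \<Omega> x else 1) \<partial>lebesgue_on \<Omega>)"
      unfolding pairing_def by (rule Bochner_Integration.integral_cong[OF refl]) (use scal[OF that] in simp)
    also have "\<dots> = moment (s j) (A j) f"
      unfolding moment_def using A[OF that] \<Omega>
      by (subst integral_restrict_space)
         (auto simp: indicator_def intro!: Bochner_Integration.integral_cong)
    finally show ?thesis .
  qed
  have maps: "\<L> \<in> lifted \<Omega> ` L1 \<Omega> \<rightarrow> bounded_fields \<Omega> q"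
  proof
    fix g
    have "bounded ((\<lambda>x. \<L> g x $ i) ` \<Omega>) \<and> (\<lambda>x. \<L> g x $ i) \<in> borel_measurable (lebesgue_on \<Omega>)"
      if "i < q" for i
    proof
      \<comment> \<open>For fixed \<open>g\<close> a component takes at most two values on
        \<open>\<Omega>\<close>, so it is bounded without any growth condition on
        \<open>\<sigma>\<close>.\<close>
      have "\<L> g x $ i \<in> {\<sigma> (?c i g * w i + b i), \<sigma> (b i)}" if "x \<in> \<Omega>" for x
        using \<open>i < q\<close> that by (cases "x \<in> P i") (simp_all add: \<L>_def)
      then show "bounded ((\<lambda>x. \<L> g x $ i) ` \<Omega>)"
        by (rule bounded_subset[OF finite_imp_bounded image_subsetI, rotated]) simp_all
      have "(\<lambda>x. \<sigma> (?c i g * (w i * indicator (P i) x) + b i)) \<in> borel_measurable (lebesgue_on \<Omega>)"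
        using borel_measurable_continuous_onI[OF \<sigma>] meas_P[OF that] by measurable
      then show "(\<lambda>x. \<L> g x $ i) \<in> borel_measurable (lebesgue_on \<Omega>)"
        by (subst measurable_cong[where g = "\<lambda>x. \<sigma> (?c i g * (w i * indicator (P i) x) + b i)"])
           (use that in \<open>auto simp: \<L>_def\<close>)
    qed
    then show "\<L> g \<in> bounded_fields \<Omega> q" by (auto simp: bounded_fields_def \<L>_def)
  qed
  have layer: "hidden_layer \<sigma> \<Omega> 2 q (lifted \<Omega> ` L1 \<Omega>) (bounded_fields \<Omega> q) \<L>"
    unfolding hidden_layer_def
  proof (rule conjI[OF maps], rule exI[of _ "0\<^sub>m q 2"], rule exI[of _ "vec q b"], rule exI[of _ q],
      rule exI[of _ ?T], rule exI[of _ ?\<psi>], rule exI[of _ ?\<phi>], intro conjI allI impI ballI)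
    fix j assume j: "j < q"
    have "bounded ((\<lambda>x. ?\<phi> j x $ i) ` \<Omega>) \<and> (\<lambda>x. ?\<phi> j x $ i) \<in> borel_measurable (lebesgue_on \<Omega>)"
      if "i < q" for i
    proof
      show "bounded ((\<lambda>x. ?\<phi> j x $ i) ` \<Omega>)"
        unfolding bounded_real using that by (auto simp: indicator_def intro!: exI[of _ "\<bar>w j\<bar>"])
      show "(\<lambda>x. ?\<phi> j x $ i) \<in> borel_measurable (lebesgue_on \<Omega>)"
        by (subst measurable_cong[where g = "\<lambda>x. if i = j then w j * indicator (P j) x else 0"])
           (use that meas_P[OF j] in auto)
    qed
    then show "?\<phi> j \<in> bounded_fields \<Omega> q" by (auto simp: bounded_fields_def)
    fix g assume "g \<in> lifted \<Omega> ` L1 \<Omega>"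
    then show "integrable (lebesgue_on \<Omega>) (\<lambda>x. (?T j *\<^sub>v g x) \<bullet> ?\<psi> j x)"
      by (elim imageE) (simp only: int[OF j])
  next
    fix g assume "g \<in> lifted \<Omega> ` L1 \<Omega>"
    then have g: "g x \<in> carrier_vec 2" if "x \<in> \<Omega>" for x using that by (auto simp: lifted_def)
    show "\<L> g = (\<lambda>x\<in>\<Omega>. map_vec \<sigma> (0\<^sub>m q 2 *\<^sub>v g x + vec q b + vec q (\<lambda>i. \<Sum>j<q. ?c j g * ?\<phi> j x $ i)))"
    proof (rule ext)
      fix x
      have "(\<Sum>j<q. ?c j g * ?\<phi> j x $ i) = (\<Sum>j<q. if j = i then ?c i g * (w i * indicator (P i) x) else 0)"
        if "i < q" "x \<in> \<Omega>" for i
        using that by (intro sum.cong) auto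
      then show "\<L> g x = (\<lambda>x\<in>\<Omega>. map_vec \<sigma> (0\<^sub>m q 2 *\<^sub>v g x + vec q b + vec q (\<lambda>i. \<Sum>j<q. ?c j g * ?\<phi> j x $ i))) x"
        using g[of x] by (cases "x \<in> \<Omega>") (auto simp: \<L>_def add.commute intro!: eq_vecI)
    qed
  qed auto
  show ?thesis
    by (rule that[OF layer]) (auto simp: \<L>_def moment neuron_def)
qed

text \<open>Reduces the theorem to finding a suitable \<open>U\<close>. The cube comes after
  \<open>U\<close>: it has to contain \<open>S\<close> and the pairing sets of the finitely many
  neurons that \<open>U\<close> uses.\<close>

lemma full_space_neural_operator_relu_hull:
  fixes U :: "('a::euclidean_space \<Rightarrow> real) \<times> 'a \<Rightarrow> real"
  assumes \<sigma>: "continuous_on UNIV \<sigma>" and U: "U \<in> relu_hull (neurons \<sigma>)" and "bounded (S :: 'a set)"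
  obtains R \<Psi> where "R > 0" and "S \<subseteq> open_cube R" and "full_space_neural_operator \<sigma> (open_cube R) \<Psi>"
    and "\<And>f x. f \<in> L1 UNIV \<Longrightarrow> \<Psi> f x = (if x \<in> open_cube R then U (f, x) else 0)"
proof -
  obtain fs0 where fs0: "set fs0 \<subseteq> neurons \<sigma>"
    and net: "\<And>gs. set fs0 \<subseteq> set gs \<Longrightarrow> \<exists>N. neural_network relu (length gs) 1 N \<and>
      (\<forall>x. N (vec (length gs) (\<lambda>i. (gs ! i) x)) = vec 1 (\<lambda>_. U x))"
    using relu_hull_network[OF U] by blast
  \<comment> \<open>the additional neuron only ensures that the width is positive\<close>
  define fs where "fs = neuron \<sigma> True {} {} 0 0 # fs0"
  define q where "q = length fs"
  \<comment> \<open>A projection network receives the coordinates of \<open>x\<close> ahead of the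
    field; as functions of \<open>(f, x)\<close> they join the neurons in the input list to which
    \<open>net\<close> is applied.\<close>
  define cs :: "(('a \<Rightarrow> real) \<times> 'a \<Rightarrow> real) list" where
    "cs = map (\<lambda>i (f, x). inner x (basis_list ! i)) [0..<DIM('a)]"
  obtain N where N: "neural_network relu (DIM('a) + q) 1 N"
    "\<And>x. N (vec (DIM('a) + q) (\<lambda>i. ((cs @ fs) ! i) x)) = vec 1 (\<lambda>_. U x)"
    using net[of "cs @ fs"] by (auto simp: fs_def q_def cs_def)
  have "fs ! i \<in> neurons \<sigma>" if "i < q" for i
  proof -
    have "neuron \<sigma> True {} {} 0 0 \<in> neurons \<sigma>" unfolding neurons_def by blast
    then have "set fs \<subseteq> neurons \<sigma>" using fs0 by (simp add: fs_def)
    then show ?thesis using that nth_mem[of i fs] by (auto simp: q_def)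
  qed
  then have "\<forall>i. \<exists>s A P w b. i < q \<longrightarrow> fs ! i = neuron \<sigma> s A P w b \<and> bounded A \<and> A \<in> sets lebesgue \<and> P \<in> sets lebesgue"
    unfolding neurons_def by blast
  then obtain s A P w b where fs: "\<And>i. i < q \<Longrightarrow> fs ! i = neuron \<sigma> (s i) (A i) (P i) (w i) (b i)"
    and AP: "\<And>i. i < q \<Longrightarrow> bounded (A i) \<and> A i \<in> sets lebesgue \<and> P i \<in> sets lebesgue"
    by metis
  have "bounded (S \<union> (\<Union>i<q. A i))" using AP \<open>bounded S\<close> by auto
  then obtain R where R: "R > 0" "S \<union> (\<Union>i<q. A i) \<subseteq> open_cube R"
    by (rule bounded_subset_open_cube)
  define \<Omega> :: "'a set" where "\<Omega> = open_cube R"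
  have \<Omega>: "bounded \<Omega>" "\<Omega> \<in> sets lebesgue"
    by (auto simp: \<Omega>_def bounded_open_cube sets_open_cube)
  have "A i \<in> sets lebesgue \<and> A i \<subseteq> \<Omega>" "P i \<in> sets lebesgue" if "i < q" for i
    using that AP R(2) by (auto simp: \<Omega>_def)
  then obtain \<L> where \<L>: "hidden_layer \<sigma> \<Omega> 2 q (lifted \<Omega> ` L1 \<Omega>) (bounded_fields \<Omega> q) \<L>"
    and \<L>_eq: "\<And>f x. f \<in> L1 UNIV \<Longrightarrow> x \<in> \<Omega> \<Longrightarrow>
      \<L> (lifted \<Omega> (restrict f \<Omega>)) x = vec q (\<lambda>i. neuron \<sigma> (s i) (A i) (P i) (w i) (b i) (f, x))"
    using hidden_layer_neurons[OF \<sigma> \<Omega>, of q A P s w b] by blast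
  define \<Q> where "\<Q> g = (\<lambda>x\<in>\<Omega>. N (coords x @\<^sub>v g x) $ 0)" for g
  have \<Q>: "projection_layer \<Omega> q (bounded_fields \<Omega> q) \<Q>"
    using projection_layer_network[OF N(1) \<Omega>] by (simp add: \<Q>_def[abs_def])
  define \<Psi>0 where "\<Psi>0 f = \<Q> (\<L> (lifted \<Omega> f))" for f
  have "neural_operator \<sigma> \<Omega> \<Psi>0"
    unfolding neural_operator_def
  proof (intro exI conjI)
    let ?d = "\<lambda>l::nat. if l = 0 then 2 else q"
    let ?F = "\<lambda>l::nat. if l = 0 then lifted \<Omega> ` L1 \<Omega> else bounded_fields \<Omega> q"
    show "0 < (1::nat)" by simp
    show "\<forall>l\<le>1. 0 < ?d l \<and> ?F l \<subseteq> \<Omega> \<rightarrow>\<^sub>E carrier_vec (?d l)"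
      by (auto simp: lifted_def bounded_fields_def q_def fs_def split: if_splits)
    show "lifting_layer \<Omega> (?d 0) (?F 0) (lifted \<Omega>)" using lifting_layer_lifted by simp
    show "\<forall>l\<in>{1..1}. hidden_layer \<sigma> \<Omega> (?d (l - 1)) (?d l) (?F (l - 1)) (?F l) \<L>" using \<L> by simp
    show "projection_layer \<Omega> (?d 1) (?F 1) \<Q>" using \<Q> by simp
    show "\<forall>f\<in>L1 \<Omega>. \<Psi>0 f = \<Q> (fold (\<lambda>_. \<L>) [1..<Suc 1] (lifted \<Omega> f))" by (simp add: \<Psi>0_def)
  qed
  \<comment> \<open>The pointwise preprocessing is the identity, written as
    \<open>relu t - relu (- t)\<close>.\<close>
  moreover have "shallow_relu_network (\<lambda>t. t)"
    unfolding shallow_relu_network_def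
    by (rule exI[of _ 2], rule exI[of _ "\<lambda>i. if i = 0 then 1 else - 1"],
        rule exI[of _ "\<lambda>i. if i = 0 then 1 else - 1"], rule exI[of _ "\<lambda>_. 0"], rule exI[of _ 0])
       (auto simp: numeral_2_eq_2 relu_def max_def)
  moreover have "restrict f \<Omega> \<in> L1 \<Omega>" if "f \<in> L1 UNIV" for f
  proof -
    have "integrable (lebesgue_on \<Omega>) f"
      using that integrable_mult_indicator[OF \<Omega>(2), of f] \<Omega>(2)
      by (simp add: L1_def integrable_restrict_space lebesgue_on_UNIV_eq)
    then have "integrable (lebesgue_on \<Omega>) (restrict f \<Omega>)"
      by (subst Bochner_Integration.integrable_cong[OF refl, where g = f]) auto
    then show ?thesis by (simp add: L1_def)
  qed
  ultimately have "full_space_neural_operator \<sigma> \<Omega> (\<lambda>f. zero_extension \<Omega> (\<Psi>0 (restrict f \<Omega>)))"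
    unfolding full_space_neural_operator_def
    by (intro exI[of _ \<Psi>0] exI[of _ "\<lambda>t. t"]) (simp add: restrict_def cong: if_cong)
  moreover have "zero_extension \<Omega> (\<Psi>0 (restrict f \<Omega>)) x = (if x \<in> \<Omega> then U (f, x) else 0)"
    if "f \<in> L1 UNIV" for f x
  proof (cases "x \<in> \<Omega>")
    case True
    have "coords x @\<^sub>v \<L> (lifted \<Omega> (restrict f \<Omega>)) x = vec (DIM('a) + q) (\<lambda>i. ((cs @ fs) ! i) (f, x))"
      using \<L>_eq[OF that True] fs by (auto simp: coords_def cs_def nth_append intro!: eq_vecI)
    with True show ?thesis by (simp add: zero_extension_def \<Psi>0_def \<Q>_def N(2))
  qed (simp add: zero_extension_def)
  ultimately show ?thesis using R that unfolding \<Omega>_def by blast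
qed


section \<open>Partitions of unity on compact sets\<close>

lemma L1_norm_diff:
  assumes "f \<in> L1 \<Omega>" and "g \<in> L1 \<Omega>"
  shows "L1_norm \<Omega> (\<lambda>x. f x - g x) = ennreal (\<integral>x. \<bar>f x - g x\<bar> \<partial>lebesgue_on \<Omega>)"
  using assms unfolding L1_norm_def L1_def by (intro nn_integral_eq_integral) auto

lemma L1_dist_triangle:
  assumes "f \<in> L1 \<Omega>" and "g \<in> L1 \<Omega>" and "h \<in> L1 \<Omega>"
  shows "(\<integral>x. \<bar>f x - h x\<bar> \<partial>lebesgue_on \<Omega>) \<le>
    (\<integral>x. \<bar>f x - g x\<bar> \<partial>lebesgue_on \<Omega>) + (\<integral>x. \<bar>g x - h x\<bar> \<partial>lebesgue_on \<Omega>)"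
proof -
  have "(\<integral>x. \<bar>f x - h x\<bar> \<partial>lebesgue_on \<Omega>) \<le> (\<integral>x. \<bar>f x - g x\<bar> + \<bar>g x - h x\<bar> \<partial>lebesgue_on \<Omega>)"
    using assms unfolding L1_def by (intro integral_mono) auto
  also have "\<dots> = (\<integral>x. \<bar>f x - g x\<bar> \<partial>lebesgue_on \<Omega>) + (\<integral>x. \<bar>g x - h x\<bar> \<partial>lebesgue_on \<Omega>)"
    using assms unfolding L1_def by (intro Bochner_Integration.integral_add) auto
  finally show ?thesis .
qed

lemma openin_L1_topologyI:
  assumes "U \<subseteq> L1 \<Omega>"
    and "\<And>f. f \<in> U \<Longrightarrow>
      \<exists>e>0. \<forall>g\<in>L1 \<Omega>. (\<integral>x. \<bar>g x - f x\<bar> \<partial>lebesgue_on \<Omega>) < e \<longrightarrow> g \<in> U"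
  shows "openin (L1_topology \<Omega>) U"
  unfolding openin_L1_topology L1_open_def
proof (intro conjI ballI)
  fix f assume f: "f \<in> U"
  then obtain e where "e > 0" "\<forall>g\<in>L1 \<Omega>. (\<integral>x. \<bar>g x - f x\<bar> \<partial>lebesgue_on \<Omega>) < e \<longrightarrow> g \<in> U"
    using assms(2) by blast
  with f assms(1) show "\<exists>e>0. \<forall>g\<in>L1 \<Omega>. L1_norm \<Omega> (\<lambda>x. g x - f x) < ennreal e \<longrightarrow> g \<in> U"
    by (intro exI[of _ e]) (auto simp: L1_norm_diff subset_iff ennreal_less_iff)
qed (fact assms(1))

lemma openin_L1_ball:
  assumes "f \<in> L1 \<Omega>"
  shows "openin (L1_topology \<Omega>) {g \<in> L1 \<Omega>. (\<integral>x. \<bar>g x - f x\<bar> \<partial>lebesgue_on \<Omega>) < r}"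
proof (rule openin_L1_topologyI)
  fix g assume g: "g \<in> {g \<in> L1 \<Omega>. (\<integral>x. \<bar>g x - f x\<bar> \<partial>lebesgue_on \<Omega>) < r}"
  have "h \<in> {g \<in> L1 \<Omega>. (\<integral>x. \<bar>g x - f x\<bar> \<partial>lebesgue_on \<Omega>) < r}"
    if "h \<in> L1 \<Omega>" "(\<integral>x. \<bar>h x - g x\<bar> \<partial>lebesgue_on \<Omega>) < r - (\<integral>x. \<bar>g x - f x\<bar> \<partial>lebesgue_on \<Omega>)" for h
    using that g L1_dist_triangle[OF that(1) _ assms, of g] by auto
  with g show "\<exists>e>0. \<forall>h\<in>L1 \<Omega>. (\<integral>x. \<bar>h x - g x\<bar> \<partial>lebesgue_on \<Omega>) < e \<longrightarrow>
      h \<in> {g \<in> L1 \<Omega>. (\<integral>x. \<bar>g x - f x\<bar> \<partial>lebesgue_on \<Omega>) < r}"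
    by (intro exI[of _ "r - (\<integral>x. \<bar>g x - f x\<bar> \<partial>lebesgue_on \<Omega>)"]) simp
qed auto

lemma continuous_map_L1_lipschitz:
  fixes F :: "_ \<Rightarrow> real"
  assumes "\<And>f g. f \<in> L1 \<Omega> \<Longrightarrow> g \<in> L1 \<Omega> \<Longrightarrow> \<bar>F g - F f\<bar> \<le> (\<integral>x. \<bar>g x - f x\<bar> \<partial>lebesgue_on \<Omega>)"
  shows "continuous_map (L1_topology \<Omega>) euclideanreal F"
  unfolding continuous_map_def topspace_L1_topology
proof (intro conjI allI impI)
  fix U :: "real set" assume "openin euclidean U"
  then have U: "open U" by simp
  show "openin (L1_topology \<Omega>) {f \<in> L1 \<Omega>. F f \<in> U}"
  proof (rule openin_L1_topologyI)
    fix f assume f: "f \<in> {f \<in> L1 \<Omega>. F f \<in> U}"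
    then obtain e where "e > 0" "ball (F f) e \<subseteq> U" using U open_contains_ball by blast
    then show "\<exists>e>0. \<forall>g\<in>L1 \<Omega>. (\<integral>x. \<bar>g x - f x\<bar> \<partial>lebesgue_on \<Omega>) < e \<longrightarrow> g \<in> {f \<in> L1 \<Omega>. F f \<in> U}"
      using f assms[of f] by (intro exI[of _ e]) (force simp: dist_real_def abs_minus_commute subset_iff)
  qed auto
qed auto

section \<open>Moments as continuous, separating functionals\<close>

lemma integrable_L1_UNIV: "f \<in> L1 UNIV \<longleftrightarrow> integrable lebesgue f"
  by (simp add: L1_def lebesgue_on_UNIV_eq)

lemma integrable_indicator_mult:
  fixes f :: "'a \<Rightarrow> real"
  shows "integrable M f \<Longrightarrow> A \<in> sets M \<Longrightarrow> integrable M (\<lambda>x. indicator A x * f x)"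
  using integrable_mult_indicator[of A M f] by simp

lemma moment_diff:
  assumes "f \<in> L1 UNIV" and "g \<in> L1 UNIV" and "A \<in> sets lebesgue"
  shows "moment True A f - moment True A g = (\<integral>x. indicator A x * (f x - g x) \<partial>lebesgue)"
  using assms unfolding moment_def integrable_L1_UNIV
  by (simp add: right_diff_distrib integrable_indicator_mult)

lemma continuous_map_moment:
  fixes A :: "'a::euclidean_space set"
  assumes "A \<in> sets lebesgue"
  shows "continuous_map (L1_topology UNIV) euclideanreal (moment True A)"
proof (rule continuous_map_L1_lipschitz)
  fix f g :: "'a \<Rightarrow> real" assume fg: "f \<in> L1 UNIV" "g \<in> L1 UNIV"
  then have int: "integrable lebesgue (\<lambda>x. \<bar>g x - f x\<bar>)" by (simp add: integrable_L1_UNIV)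
  have "\<bar>moment True A g - moment True A f\<bar> \<le> (\<integral>x. \<bar>g x - f x\<bar> \<partial>lebesgue)"
    unfolding moment_diff[OF fg(2,1) assms]
  proof (rule integral_abs_bound_integral[OF integrable_indicator_mult[OF _ assms] int])
    show "integrable lebesgue (\<lambda>x. g x - f x)" using fg by (simp add: integrable_L1_UNIV)
  qed (auto simp: indicator_def)
  then show "\<bar>moment True A g - moment True A f\<bar> \<le> (\<integral>x. \<bar>g x - f x\<bar> \<partial>lebesgue_on UNIV)"
    by (simp add: lebesgue_on_UNIV_eq)
qed

text \<open>Test with the part of \<open>{x. 0 < h x}\<close> in a cube: there \<open>h\<close> is
  positive with integral zero, so this part is a null set. Countably many cubes exhaust the
  space.\<close>

lemma AE_nonpos_if_bounded_integrals_zero: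
  fixes h :: "'a::euclidean_space \<Rightarrow> real"
  assumes h: "integrable lebesgue h"
    and 0: "\<And>A. bounded A \<Longrightarrow> A \<in> sets lebesgue \<Longrightarrow> (\<integral>x. indicator A x * h x \<partial>lebesgue) = 0"
  shows "AE x in lebesgue. h x \<le> 0"
proof -
  have "AE x in lebesgue. h x \<le> 0 \<or> x \<notin> open_cube (real n)" for n
  proof -
    define A where "A = {x. 0 < h x} \<inter> open_cube (real n)"
    have "h \<in> borel_measurable lebesgue" using h by simp
    then have "{x. 0 < h x} \<in> sets lebesgue"
      using measurable_sets[of h lebesgue borel "{0<..}"] by (simp add: vimage_def)
    then have A: "A \<in> sets lebesgue" "bounded A"
      unfolding A_def using sets_open_cube bounded_open_cube bounded_subset[OF bounded_open_cube] by auto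
    have "AE x in lebesgue. indicator A x * h x = 0"
      using integral_nonneg_eq_0_iff_AE[OF integrable_indicator_mult[OF h A(1)]] 0[OF A(2,1)]
      by (auto simp: A_def indicator_def)
    then show ?thesis by eventually_elim (auto simp: A_def indicator_def split: if_splits)
  qed
  then have "AE x in lebesgue. \<forall>n. h x \<le> 0 \<or> x \<notin> open_cube (real n)"
    by (rule AE_all_countable[THEN iffD2, rule_format])
  then show ?thesis
  proof eventually_elim
    case (elim x)
    obtain R where "R > 0" "{x} \<subseteq> open_cube R" using bounded_subset_open_cube[of "{x}"] by auto
    moreover obtain n where "R \<le> real n" using real_arch_simple by blast
    ultimately have "x \<in> open_cube (real n)" by (force simp: mem_open_cube)
    with elim show ?case by auto
  qed
qed

text \<open>Otherwise the one-sided criterion applies to \<open>f - g\<close> and to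
  \<open>g - f\<close>. Positive distance stands for being different, since functions are only
  representatives of their classes.\<close>

lemma L1_separated_by_moment:
  fixes f g :: "'a::euclidean_space \<Rightarrow> real"
  assumes f: "f \<in> L1 UNIV" and g: "g \<in> L1 UNIV" and "(\<integral>x. \<bar>f x - g x\<bar> \<partial>lebesgue) > 0"
  shows "\<exists>A. bounded A \<and> A \<in> sets lebesgue \<and> moment True A f \<noteq> moment True A g"
proof (rule ccontr)
  assume *: "\<not> ?thesis"
  have 0: "(\<integral>x. indicator A x * (f x - g x) \<partial>lebesgue) = 0" if "bounded A" "A \<in> sets lebesgue" for A
  proof -
    have "moment True A f = moment True A g" using * that by blast
    then show ?thesis using moment_diff[OF f g that(2)] by simp
  qed
  have "AE x in lebesgue. f x - g x \<le> 0"
    by (rule AE_nonpos_if_bounded_integrals_zero) (use f g 0 in \<open>auto simp: integrable_L1_UNIV\<close>)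
  moreover have "AE x in lebesgue. g x - f x \<le> 0"
  proof (rule AE_nonpos_if_bounded_integrals_zero)
    fix A :: "'a set" assume A: "bounded A" "A \<in> sets lebesgue"
    have "(\<integral>x. indicator A x * (g x - f x) \<partial>lebesgue) = (\<integral>x. - (indicator A x * (f x - g x)) \<partial>lebesgue)"
      by (rule Bochner_Integration.integral_cong) (auto simp: algebra_simps)
    then show "(\<integral>x. indicator A x * (g x - f x) \<partial>lebesgue) = 0" using 0[OF A] by simp
  qed (use f g in \<open>auto simp: integrable_L1_UNIV\<close>)
  ultimately have "AE x in lebesgue. \<bar>f x - g x\<bar> = 0" by eventually_elim auto
  then have "(\<integral>x. \<bar>f x - g x\<bar> \<partial>lebesgue) = 0" by (rule integral_eq_zero_AE)
  with assms(3) show False by simp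
qed

section \<open>Lattice operations and bump functions\<close>

lemma relu_hull_sum:
  "(\<And>i. i \<in> I \<Longrightarrow> u i \<in> relu_hull F) \<Longrightarrow> (\<lambda>x. \<Sum>i\<in>I. u i x) \<in> relu_hull F"
  by (induction I rule: infinite_finite_induct) (auto intro: relu_hull.intros)

lemma relu_hull_diff: "u \<in> relu_hull F \<Longrightarrow> v \<in> relu_hull F \<Longrightarrow> (\<lambda>x. u x - v x) \<in> relu_hull F"
  using relu_hull.add[OF _ relu_hull.scale[of v F "- 1"], of u] by simp

lemma relu_hull_abs: "u \<in> relu_hull F \<Longrightarrow> (\<lambda>x. \<bar>u x\<bar>) \<in> relu_hull F"
proof -
  assume u: "u \<in> relu_hull F"
  have "(\<lambda>x. relu (u x) + relu (- 1 * u x)) \<in> relu_hull F" by (intro relu_hull.intros u)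
  also have "(\<lambda>x. relu (u x) + relu (- 1 * u x)) = (\<lambda>x. \<bar>u x\<bar>)" by (auto simp: relu_def fun_eq_iff)
  finally show ?thesis .
qed

lemma relu_hull_max: "u \<in> relu_hull F \<Longrightarrow> v \<in> relu_hull F \<Longrightarrow> (\<lambda>x. max (u x) (v x)) \<in> relu_hull F"
proof -
  assume uv: "u \<in> relu_hull F" "v \<in> relu_hull F"
  have "(\<lambda>x. u x + relu (v x - u x)) \<in> relu_hull F" by (intro relu_hull.intros relu_hull_diff uv)
  also have "(\<lambda>x. u x + relu (v x - u x)) = (\<lambda>x. max (u x) (v x))" by (auto simp: relu_def fun_eq_iff)
  finally show ?thesis .
qed

text \<open>Two different moments can be carried by an affine map to \<open>s\<close> and
  \<open>t\<close>, two points where \<open>\<sigma>\<close> takes different values;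
  \<open>w\<close> and \<open>b\<close> are its slope and intercept.\<close>

lemma separating_neuron:
  fixes f g :: "'a::euclidean_space \<Rightarrow> real"
  assumes \<sigma>: "continuous_on UNIV \<sigma>" "\<sigma> s \<noteq> \<sigma> t"
    and fg: "f \<in> L1 UNIV" "g \<in> L1 UNIV" "(\<integral>x. \<bar>f x - g x\<bar> \<partial>lebesgue) > 0"
  shows "\<exists>e. (\<lambda>(f, x). e f) \<in> relu_hull (neurons \<sigma> :: (('a \<Rightarrow> real) \<times> 'a \<Rightarrow> real) set) \<and>
    continuous_map (L1_topology UNIV) euclideanreal e \<and> e f \<noteq> e g"
proof -
  obtain A where A: "bounded A" "A \<in> sets lebesgue" "moment True A f \<noteq> moment True A g"
    using L1_separated_by_moment[OF fg] by blast
  define w where "w = (s - t) / (moment True A f - moment True A g)"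
  define b where "b = s - moment True A f * w"
  have wb: "moment True A f * w + b = s" "moment True A g * w + b = t"
  proof -
    have "moment True A f * w - moment True A g * w = s - t"
      unfolding left_diff_distrib[symmetric] using A(3) by (simp add: w_def)
    then show "moment True A f * w + b = s" "moment True A g * w + b = t" by (simp_all add: b_def)
  qed
  show ?thesis
  proof (intro exI conjI)
    have "(UNIV :: 'a set) \<in> sets lebesgue" by simp
    then have "neuron \<sigma> True A UNIV w b \<in> neurons \<sigma>" unfolding neurons_def using A by blast
    then show "(\<lambda>(f, x). \<sigma> (moment True A f * w + b)) \<in> relu_hull (neurons \<sigma> :: (('a \<Rightarrow> real) \<times> 'a \<Rightarrow> real) set)"
      using relu_hull.base by (fastforce simp: neuron_def)
    have "continuous_map (L1_topology UNIV) euclideanreal (\<sigma> \<circ> (\<lambda>f. moment True A f * w + b))"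
      by (rule continuous_map_compose[OF continuous_map_add[OF continuous_map_real_mult_right
            [OF continuous_map_moment[OF A(2)]] continuous_map_const[THEN iffD2]]])
         (use \<sigma> in auto)
    then show "continuous_map (L1_topology UNIV) euclideanreal (\<lambda>f. \<sigma> (moment True A f * w + b))"
      by (simp add: comp_def)
    show "\<sigma> (moment True A f * w + b) \<noteq> \<sigma> (moment True A g * w + b)" using wb \<sigma>(2) by simp
  qed
qed

text \<open>A substitute for the distance to \<open>f0\<close>, which need not be computable from
  finitely many neurons. Each far point of \<open>K\<close> is separated from \<open>f0\<close> by a
  neuron, and by compactness finitely many of these suffice. Nonnegativity keeps the summands from
  cancelling.\<close>

lemma relu_bump:
  fixes K :: "('a::euclidean_space \<Rightarrow> real) set"
  assumes \<sigma>: "continuous_on UNIV \<sigma>" "\<sigma> s \<noteq> \<sigma> t"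
    and K: "compactin (L1_topology UNIV) K" and f0: "f0 \<in> L1 UNIV" and "\<eta> > 0"
  shows "\<exists>D. (\<lambda>(f, x). D f) \<in> relu_hull (neurons \<sigma> :: (('a \<Rightarrow> real) \<times> 'a \<Rightarrow> real) set) \<and>
    continuous_map (L1_topology UNIV) euclideanreal D \<and> (\<forall>f. 0 \<le> D f) \<and> D f0 = 0 \<and>
    (\<forall>f\<in>K. \<eta> \<le> (\<integral>x. \<bar>f x - f0 x\<bar> \<partial>lebesgue) \<longrightarrow> 1 < D f)"
proof -
  define G where "G = {g \<in> K. \<eta> \<le> (\<integral>x. \<bar>g x - f0 x\<bar> \<partial>lebesgue)}"
  have KL: "K \<subseteq> L1 UNIV" using K by (simp add: compactin_def topspace_L1_topology)
  have "\<exists>e. (\<lambda>(f, x). e f) \<in> relu_hull (neurons \<sigma> :: (('a \<Rightarrow> real) \<times> 'a \<Rightarrow> real) set) \<and>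
      continuous_map (L1_topology UNIV) euclideanreal e \<and> e g \<noteq> e f0" if "g \<in> G" for g
  proof -
    have "g \<in> L1 UNIV" "(\<integral>x. \<bar>g x - f0 x\<bar> \<partial>lebesgue) > 0"
      using that KL \<open>\<eta> > 0\<close> by (auto simp: G_def)
    from separating_neuron[OF \<sigma> this(1) f0 this(2)] show ?thesis .
  qed
  then obtain e where e: "\<And>g. g \<in> G \<Longrightarrow> (\<lambda>(f, x). e g f) \<in> relu_hull (neurons \<sigma> :: (('a \<Rightarrow> real) \<times> 'a \<Rightarrow> real) set)"
    "\<And>g. g \<in> G \<Longrightarrow> continuous_map (L1_topology UNIV) euclideanreal (e g)" "\<And>g. g \<in> G \<Longrightarrow> e g g \<noteq> e g f0"
    by metis
  \<comment> \<open>The factor makes \<open>E g g = 2\<close> and \<open>E g f0 = 0\<close>, so that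
    \<open>{f. 1 < E g f}\<close> is a neighbourhood of \<open>g\<close>.\<close>
  define E where "E g f = 2 / \<bar>e g g - e g f0\<bar> * \<bar>e g f - e g f0\<bar>" for g f
  have E: "continuous_map (L1_topology UNIV) euclideanreal (E g)" if "g \<in> G" for g
    unfolding E_def by (intro continuous_intros e that) auto
  define W where "W g = {f \<in> L1 UNIV. E g f \<in> {1<..}}" for g
  \<comment> \<open>The ball completes the cover of \<open>K\<close>. It contains no far point, so
    once it is removed from the subcover the remaining sets still cover all far points.\<close>
  define B where "B = {f \<in> L1 UNIV. (\<integral>x. \<bar>f x - f0 x\<bar> \<partial>lebesgue_on UNIV) < \<eta>}"
  have "\<forall>U\<in>insert B (W ` G). openin (L1_topology UNIV) U"
    using openin_L1_ball[OF f0, of \<eta>] openin_continuous_map_preimage[OF E, of _ "{1<..}"]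
    by (auto simp: W_def B_def topspace_L1_topology)
  moreover have "K \<subseteq> \<Union>(insert B (W ` G))"
  proof
    fix f assume f: "f \<in> K"
    then have "f \<in> L1 UNIV" using KL by blast
    moreover have "f \<in> W f" if "f \<in> G" using e(3)[OF that] \<open>f \<in> L1 UNIV\<close> by (simp add: W_def E_def)
    ultimately show "f \<in> \<Union>(insert B (W ` G))"
      using f by (cases "f \<in> G") (auto simp: G_def B_def lebesgue_on_UNIV_eq)
  qed
  ultimately obtain V where V: "finite V" "V \<subseteq> insert B (W ` G)" "K \<subseteq> \<Union>V"
    using K unfolding compactin_def by meson
  have "finite (V - {B})" "V - {B} \<subseteq> W ` G" using V(1,2) by auto
  then obtain G' where G': "finite G'" "G' \<subseteq> G" "V - {B} = W ` G'"
    using finite_subset_image by metis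
  define D where "D f = (\<Sum>g\<in>G'. E g f)" for f
  show ?thesis
  proof (intro exI conjI allI ballI impI)
    have "(\<lambda>p. \<Sum>g\<in>G'. 2 / \<bar>e g g - e g f0\<bar> * \<bar>(case p of (f, x) \<Rightarrow> e g f) - e g f0\<bar>)
        \<in> relu_hull (neurons \<sigma> :: (('a \<Rightarrow> real) \<times> 'a \<Rightarrow> real) set)"
      using G' e(1) by (intro relu_hull_sum relu_hull.scale relu_hull_abs relu_hull_diff relu_hull.const) auto
    also have "(\<lambda>p. \<Sum>g\<in>G'. 2 / \<bar>e g g - e g f0\<bar> * \<bar>(case p of (f, x) \<Rightarrow> e g f) - e g f0\<bar>) = (\<lambda>(f, x). D f)"
      by (auto simp: D_def E_def fun_eq_iff)
    finally show "(\<lambda>(f, x). D f) \<in> relu_hull (neurons \<sigma> :: (('a \<Rightarrow> real) \<times> 'a \<Rightarrow> real) set)" .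
    show "continuous_map (L1_topology UNIV) euclideanreal D"
      unfolding D_def using G' E by (intro continuous_map_sum) auto
    show "0 \<le> D f" for f by (simp add: D_def E_def sum_nonneg)
    show "D f0 = 0" by (simp add: D_def E_def)
    fix f assume f: "f \<in> K" "\<eta> \<le> (\<integral>x. \<bar>f x - f0 x\<bar> \<partial>lebesgue)"
    then have "f \<notin> B" by (auto simp: B_def lebesgue_on_UNIV_eq)
    then obtain g where g: "g \<in> G'" "f \<in> W g" using V(3) G'(3) f(1) by blast
    then have "1 < E g f" by (simp add: W_def)
    also have "E g f \<le> D f" unfolding D_def
      using G' g by (intro member_le_sum) (auto simp: E_def)
    finally show "1 < D f" .
  qed
qed

text \<open>The increments of the running maximum of the cut-offs \<open>\<tau>\<close> telescope to
  the overall maximum, which is \<open>1\<close> on \<open>K\<close>. A nonzero increment at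
  \<open>k\<close> forces the cut-off at \<open>k\<close> to be positive, hence \<open>f\<close> to
  be near the centre with index \<open>k\<close>.\<close>

lemma relu_partition_of_unity:
  fixes K :: "('a::euclidean_space \<Rightarrow> real) set"
  assumes \<sigma>: "continuous_on UNIV \<sigma>" "\<sigma> s \<noteq> \<sigma> t"
    and K: "compactin (L1_topology UNIV) K" and "\<eta> > 0"
  obtains n :: nat and c \<chi> where "\<And>k. k < n \<Longrightarrow> c k \<in> K"
    and "\<And>k. k < n \<Longrightarrow> (\<lambda>(f, x). \<chi> k f) \<in> relu_hull (neurons \<sigma> :: (('a \<Rightarrow> real) \<times> 'a \<Rightarrow> real) set)"
    and "\<And>k f. k < n \<Longrightarrow> 0 \<le> \<chi> k f \<and> \<chi> k f \<le> 1"
    and "\<And>f. f \<in> K \<Longrightarrow> (\<Sum>k<n. \<chi> k f) = 1"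
    and "\<And>k f. k < n \<Longrightarrow> f \<in> K \<Longrightarrow> \<chi> k f \<noteq> 0 \<Longrightarrow> (\<integral>x. \<bar>f x - c k x\<bar> \<partial>lebesgue) < \<eta>"
proof -
  let ?H = "relu_hull (neurons \<sigma> :: (('a \<Rightarrow> real) \<times> 'a \<Rightarrow> real) set)"
  have KL: "K \<subseteq> L1 UNIV" using K by (simp add: compactin_def topspace_L1_topology)
  have "\<forall>g\<in>K. \<exists>D. (\<lambda>(f, x). D f) \<in> ?H \<and> continuous_map (L1_topology UNIV) euclideanreal D \<and>
      (\<forall>f. 0 \<le> D f) \<and> D g = 0 \<and> (\<forall>f\<in>K. \<eta> \<le> (\<integral>x. \<bar>f x - g x\<bar> \<partial>lebesgue) \<longrightarrow> 1 < D f)"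
    using relu_bump[OF \<sigma> K _ \<open>\<eta> > 0\<close>] KL by blast
  from bchoice[OF this] obtain D where D: "\<And>g. g \<in> K \<Longrightarrow> (\<lambda>(f, x). D g f) \<in> ?H"
    "\<And>g. g \<in> K \<Longrightarrow> continuous_map (L1_topology UNIV) euclideanreal (D g)"
    "\<And>g f. g \<in> K \<Longrightarrow> 0 \<le> D g f" "\<And>g. g \<in> K \<Longrightarrow> D g g = 0"
    "\<And>g f. g \<in> K \<Longrightarrow> f \<in> K \<Longrightarrow> \<eta> \<le> (\<integral>x. \<bar>f x - g x\<bar> \<partial>lebesgue) \<Longrightarrow> 1 < D g f"
    by auto
  define W where "W g = {f \<in> L1 UNIV. D g f \<in> {..<1/2}}" for g
  have "\<forall>U\<in>W ` K. openin (L1_topology UNIV) U"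
    using openin_continuous_map_preimage[OF D(2), of _ "{..<1/2}"] by (auto simp: W_def topspace_L1_topology)
  moreover have "K \<subseteq> \<Union>(W ` K)" using D(4) KL by (force simp: W_def)
  ultimately obtain V where V: "finite V" "V \<subseteq> W ` K" "K \<subseteq> \<Union>V"
    using K unfolding compactin_def by meson
  then obtain G where G: "finite G" "G \<subseteq> K" "V = W ` G"
    using finite_subset_image[of V W K] by blast
  obtain cs where cs: "set cs = G" using finite_list[OF G(1)] by blast
  have csK: "cs ! k \<in> K" if "k < length cs" for k using that cs G(2) nth_mem by blast
  \<comment> \<open>This is \<open>2 - 2 * D\<close> clamped to the unit interval: it is
    \<open>1\<close> where \<open>D \<le> 1/2\<close>, hence on the covering sets \<open>W\<close>,
    and \<open>0\<close> where \<open>D \<ge> 1\<close>, hence at the far points of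
    \<open>K\<close>.\<close>
  define \<tau> where "\<tau> k f = 1 - relu (1 - relu (2 - 2 * D (cs ! k) f))" for k f
  have \<tau>01: "0 \<le> \<tau> k f" "\<tau> k f \<le> 1" for k f by (auto simp: \<tau>_def relu_def)
  \<comment> \<open>\<open>M k f\<close> is the maximum of \<open>0\<close> and the values of the
    first \<open>k\<close> cut-offs at \<open>f\<close>.\<close>
  define M where "M k f = rec_nat 0 (\<lambda>k m. max m (\<tau> k f)) k" for k :: nat and f
  have M_0: "M 0 f = 0" and M_Suc: "M (Suc k) f = max (M k f) (\<tau> k f)" for k f
    by (simp_all add: M_def)
  have M01: "0 \<le> M k f \<and> M k f \<le> 1" for k f
    by (induction k) (use \<tau>01 in \<open>auto simp: M_0 M_Suc max_def\<close>)
  have M_ge: "\<tau> k f \<le> M n f" if "k < n" for k n f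
    using that by (induction n) (auto simp: M_Suc less_Suc_eq intro: max.coboundedI1)
  have M_H: "(\<lambda>(f, x). M k f) \<in> ?H" if "k \<le> length cs" for k
    using that
  proof (induction k)
    case 0
    then show ?case using relu_hull.const[of 0] by (simp add: M_0 case_prod_beta)
  next
    case (Suc k)
    have "(\<lambda>p. max (case p of (f, x) \<Rightarrow> M k f)
        (1 - relu (1 - relu (2 - 2 * (case p of (f, x) \<Rightarrow> D (cs ! k) f))))) \<in> ?H"
      using Suc csK by (intro relu_hull_max relu_hull_diff relu_hull.const relu_hull.relu relu_hull.scale D(1)) auto
    then show ?case by (simp add: M_Suc \<tau>_def case_prod_beta)
  qed
  define \<chi> where "\<chi> k f = M (Suc k) f - M k f" for k f
  show thesis
  proof
    fix k assume k: "k < length cs"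
    show "cs ! k \<in> K" by (rule csK[OF k])
    have "(\<lambda>p. (case p of (f, x) \<Rightarrow> M (Suc k) f) - (case p of (f, x) \<Rightarrow> M k f)) \<in> ?H"
      using k by (intro relu_hull_diff M_H) auto
    then show "(\<lambda>(f, x). \<chi> k f) \<in> ?H" by (simp add: \<chi>_def case_prod_unfold)
    show "0 \<le> \<chi> k f \<and> \<chi> k f \<le> 1" for f
      using M01[of k f] M01[of "Suc k" f] by (auto simp: \<chi>_def M_Suc)
    fix f assume f: "f \<in> K" "\<chi> k f \<noteq> 0"
    then have "0 < \<tau> k f" using M01[of k f] by (auto simp: \<chi>_def M_Suc max_def split: if_splits)
    then have "D (cs ! k) f < 1" by (auto simp: \<tau>_def relu_def max_def split: if_splits)
    then show "(\<integral>x. \<bar>f x - (cs ! k) x\<bar> \<partial>lebesgue) < \<eta>"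
      using D(5)[OF csK[OF k] f(1)] by force
  next
    fix f assume f: "f \<in> K"
    then obtain g where "g \<in> G" "f \<in> W g" using V(3) G(3) by blast
    then obtain k where k: "k < length cs" "f \<in> W (cs ! k)" using cs by (metis in_set_conv_nth)
    then have "\<tau> k f = 1" using D(3)[OF csK[OF k(1)], of f] by (auto simp: W_def \<tau>_def relu_def)
    then have "M (length cs) f = 1" using M_ge[OF k(1), of f] M01[of "length cs" f] by simp
    then show "(\<Sum>k<length cs. \<chi> k f) = 1"
      unfolding \<chi>_def by (subst sum_lessThan_telescope) (simp add: M_0)
  qed
qed


section \<open>Conditioning\<close>

lemma AE_lborel_slices:
  fixes P :: "'a::euclidean_space \<times> 'b::euclidean_space \<Rightarrow> bool"
  assumes "AE z in lborel. P z"
  shows "AE y in lborel. AE x in lborel. P (x, y)"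
proof -
  obtain N where N: "N \<in> null_sets lborel" "{z. \<not> P z} \<subseteq> N"
    using assms by (auto elim!: AE_E simp: null_sets_def)
  have "N \<in> null_sets (lborel \<Otimes>\<^sub>M lborel)" using N(1) by (simp only: lborel_prod)
  then have N': "N \<in> sets (lborel \<Otimes>\<^sub>M lborel)" "emeasure (lborel \<Otimes>\<^sub>M lborel) N = 0"
    by blast+
  have ind: "(indicator N :: 'a \<times> 'b \<Rightarrow> ennreal) \<in> borel_measurable (lborel \<Otimes>\<^sub>M lborel)"
    using N'(1) by simp
  have meas: "(\<lambda>y. \<integral>\<^sup>+x. indicator N (x, y) \<partial>lborel) \<in> borel_measurable (lborel :: 'b measure)"
    using lborel.borel_measurable_nn_integral_fst[OF measurable_pair_swap[OF ind]] by simp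
  have "(\<integral>\<^sup>+y. (\<integral>\<^sup>+x. indicator N (x, y) \<partial>lborel) \<partial>lborel) = 0"
    using lborel_pair.nn_integral_snd[OF ind] N' by simp
  then have "AE y in lborel. (\<integral>\<^sup>+x. indicator N (x, y) \<partial>lborel) = 0"
    using nn_integral_0_iff_AE[OF meas] by simp
  then show ?thesis
  proof eventually_elim
    case (elim y)
    have "(\<lambda>x. indicator N (x, y) :: ennreal) \<in> borel_measurable lborel"
      using measurable_compose[OF measurable_Pair2' ind] by simp
    with elim have "AE x in lborel. indicator N (x, y) = (0 :: ennreal)"
      using nn_integral_0_iff_AE by blast
    then show ?case by eventually_elim (use N(2) in \<open>auto simp: indicator_def split: if_splits\<close>)
  qed
qed

lemma AE_lborel_snd:
  assumes "AE y in (lborel :: 'b::euclidean_space measure). P y"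
  shows "AE z in (lborel :: ('a::euclidean_space \<times> 'b) measure). P (snd z)"
proof -
  obtain N where N: "N \<in> null_sets (lborel :: 'b measure)" "{y. \<not> P y} \<subseteq> N"
    using assms by (auto elim!: AE_E simp: null_sets_def)
  then have "UNIV \<times> N \<in> null_sets (lborel \<Otimes>\<^sub>M lborel :: ('a \<times> 'b) measure)"
    by (intro lborel.times_in_null_sets2) auto
  then have "UNIV \<times> N \<in> null_sets (lborel :: ('a \<times> 'b) measure)" by (simp add: lborel_prod)
  moreover have "{z :: 'a \<times> 'b. \<not> P (snd z)} \<subseteq> UNIV \<times> N" using N(2) by auto
  ultimately show ?thesis by (intro AE_I'[of "UNIV \<times> N"]) auto
qed

text \<open>Lebesgue measure on a product is only the completion of the product measure, so Fubini
  is applied to a Borel version \<open>g\<close>. Almost every slice of \<open>f\<close> agrees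
  almost everywhere with that of \<open>g\<close>, which identifies the marginals.\<close>

lemma integrable_borel_version:
  fixes f :: "'a::euclidean_space \<times> 'b::euclidean_space \<Rightarrow> real"
  assumes f: "integrable lebesgue f"
  obtains g where "integrable lborel g" and "AE z in lborel. f z = g z"
    and "AE y in lborel. integrable lborel (\<lambda>x. g (x, y)) \<and> marginal f y = (\<integral>x. g (x, y) \<partial>lborel)"
proof -
  obtain g where g: "g \<in> borel_measurable lborel" "AE z in lborel. f z = g z"
    using completion_ex_borel_measurable_real[OF borel_measurable_integrable[OF f]] by auto
  have "integrable lebesgue g"
    using f g by (subst integrable_cong_AE[where g = f]) (auto intro: AE_completion measurable_completion)
  then have int: "integrable lborel g" using g(1) by (simp add: integrable_completion)
  then have "integrable (lborel \<Otimes>\<^sub>M lborel) (\<lambda>(x, y). g (x, y))" by (simp add: lborel_prod)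
  then have "AE y in lborel. integrable lborel (\<lambda>x. g (x, y))"
    by (rule lborel_pair.AE_integrable_snd)
  moreover have "AE y in lborel. AE x in lborel. f (x, y) = g (x, y)"
    by (rule AE_lborel_slices[OF g(2)])
  ultimately have "AE y in lborel. integrable lborel (\<lambda>x. g (x, y)) \<and> marginal f y = (\<integral>x. g (x, y) \<partial>lborel)"
  proof eventually_elim
    case (elim y)
    then have meas: "(\<lambda>x. g (x, y)) \<in> borel_measurable lborel" by auto
    have eq: "AE x in lebesgue. g (x, y) = f (x, y)"
      using elim by (intro AE_completion) auto
    have "(\<lambda>x. f (x, y)) \<in> borel_measurable lebesgue"
      using borel_measurable_AE[OF measurable_completion[OF meas] eq] .
    then have "marginal f y = (\<integral>x. g (x, y) \<partial>lebesgue)"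
      unfolding marginal_def using eq meas by (intro integral_cong_AE) (auto intro: measurable_completion)
    with elim meas show ?case by (simp add: integral_completion)
  qed
  with int g(2) that show thesis by blast
qed

lemma cond_domain_borel_version:
  fixes f :: "'a::euclidean_space \<times> 'b::euclidean_space \<Rightarrow> real"
  assumes f: "f \<in> cond_domain \<delta> B" and B: "open B" and \<delta>: "\<delta> > 0"
  obtains g m where "g \<in> borel_measurable lborel" and "m \<in> borel_measurable lborel"
    and "AE z in lborel. f z = g z"
    and "AE y in lborel. integrable lborel (\<lambda>x. g (x, y)) \<and> m y = (\<integral>x. g (x, y) \<partial>lborel)"
    and "AE y in lborel. AE x in lborel. 0 \<le> g (x, y)"
    and "AE y in lborel. y \<in> B \<longrightarrow> \<delta> / 2 < m y"
    and "AE z in lborel. z \<in> UNIV \<times> B \<longrightarrow> kernel_conditioning B f z = g z / m (snd z)"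
proof -
  have int: "integrable lebesgue f" and nonneg: "AE z in lebesgue. 0 \<le> f z"
    and ess: "ereal \<delta> \<le> essinf (lebesgue_on B) (marginal f)"
    using f by (auto simp: cond_domain_def densities_def L1_def lebesgue_on_UNIV_eq)
  obtain g where g: "integrable lborel g" "AE z in lborel. f z = g z"
    and m: "AE y in lborel. integrable lborel (\<lambda>x. g (x, y)) \<and> marginal f y = (\<integral>x. g (x, y) \<partial>lborel)"
    using integrable_borel_version[OF int] .
  define m where "m y = (\<integral>x. g (x, y) \<partial>lborel)" for y
  have meas: "g \<in> borel_measurable (lborel \<Otimes>\<^sub>M lborel)" using g(1) by (auto simp: lborel_prod)
  show thesis
  proof
    show "g \<in> borel_measurable lborel" "AE z in lborel. f z = g z" using g by auto
    show "m \<in> borel_measurable lborel"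
      using lborel.borel_measurable_lebesgue_integral[of "\<lambda>y x. g (x, y)" lborel] measurable_pair_swap[OF meas]
      by (simp add: m_def[abs_def] case_prod_beta')
    show "AE y in lborel. integrable lborel (\<lambda>x. g (x, y)) \<and> m y = (\<integral>x. g (x, y) \<partial>lborel)"
      using m by eventually_elim (simp add: m_def)
    have "AE z in lborel. 0 \<le> f z" using nonneg by (simp add: AE_completion_iff)
    with g(2) have "AE z in lborel. 0 \<le> g z" by eventually_elim simp
    then show "AE y in lborel. AE x in lborel. 0 \<le> g (x, y)" by (rule AE_lborel_slices)
    \<comment> \<open>A limit inferior of at least \<open>\<delta>\<close> bounds the marginal from
      below almost everywhere by each constant smaller than \<open>\<delta>\<close>. The choice of
      \<open>\<delta> / 2\<close> costs a factor \<open>2\<close> in the Lipschitz constant.\<close>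
    have "ereal (\<delta> / 2) < ereal \<delta>" using \<delta> by simp
    then have "AE y in lebesgue_on B. ereal (\<delta> / 2) < ereal (marginal f y)"
      using ess unfolding essinf_def le_Liminf_iff by blast
    then have "AE y in lebesgue. y \<in> B \<longrightarrow> \<delta> / 2 < marginal f y"
      using B by (subst (asm) AE_restrict_space_iff) auto
    then have "AE y in lborel. y \<in> B \<longrightarrow> \<delta> / 2 < marginal f y" by (simp add: AE_completion_iff)
    with m show "AE y in lborel. y \<in> B \<longrightarrow> \<delta> / 2 < m y" by eventually_elim (simp add: m_def)
    have "AE y in lborel. marginal f y = m y" using m by eventually_elim (simp add: m_def)
    from AE_lborel_snd[OF this] g(2)
    show "AE z in lborel. z \<in> UNIV \<times> B \<longrightarrow> kernel_conditioning B f z = g z / m (snd z)"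
      by eventually_elim (auto simp: kernel_conditioning_def)
  qed
qed

text \<open>Tonelli with \<open>y\<close> as the outer variable, for an integrand accessible only
  through a Borel version \<open>k\<close>.\<close>

lemma nn_integral_Times_lborel:
  fixes h :: "'a::euclidean_space \<times> 'b::euclidean_space \<Rightarrow> ennreal"
  assumes B: "open B" and meas: "k \<in> borel_measurable lborel"
    and eq: "AE z in lborel. z \<in> UNIV \<times> B \<longrightarrow> h z = k z"
  shows "(\<integral>\<^sup>+z. h z \<partial>lebesgue_on (UNIV \<times> B)) = (\<integral>\<^sup>+y. (\<integral>\<^sup>+x. k (x, y) \<partial>lborel) * indicator B y \<partial>lborel)"
proof -
  have UB: "UNIV \<times> B \<in> sets borel" "UNIV \<times> B \<in> sets lebesgue" using B by (auto simp: open_Times)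
  have meas': "(\<lambda>z. k z * indicator (UNIV \<times> B) z) \<in> borel_measurable (lborel \<Otimes>\<^sub>M lborel)"
    unfolding lborel_prod using UB(1) by (intro borel_measurable_times_ennreal meas borel_measurable_indicator) simp
  have k: "(\<lambda>x. k (x, y)) \<in> borel_measurable lborel" for y
    using measurable_Pair1[of k lborel lborel borel y] meas by (simp add: lborel_prod)
  have "(\<integral>\<^sup>+z. h z \<partial>lebesgue_on (UNIV \<times> B)) = (\<integral>\<^sup>+z. h z * indicator (UNIV \<times> B) z \<partial>lborel)"
    using UB(2) by (subst nn_integral_restrict_space) (simp_all add: nn_integral_completion)
  also have "\<dots> = (\<integral>\<^sup>+z. k z * indicator (UNIV \<times> B) z \<partial>lborel)"
    by (rule nn_integral_cong_AE) (use eq in \<open>eventually_elim, auto simp: indicator_def\<close>)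
  also have "\<dots> = (\<integral>\<^sup>+y. (\<integral>\<^sup>+x. k (x, y) * indicator (UNIV \<times> B) (x, y) \<partial>lborel) \<partial>lborel)"
    using lborel_pair.nn_integral_snd[OF meas'] by (simp add: lborel_prod)
  also have "\<dots> = (\<integral>\<^sup>+y. (\<integral>\<^sup>+x. k (x, y) \<partial>lborel) * indicator B y \<partial>lborel)"
    using k by (intro nn_integral_cong) (auto simp: indicator_def)
  finally show ?thesis .
qed

text \<open>For almost every \<open>y\<close> in \<open>B\<close> the kernel is a probability
  density in \<open>x\<close>, so its norm is the measure of \<open>B\<close>, which is
  finite.\<close>

lemma integrable_kernel_conditioning:
  fixes f :: "'a::euclidean_space \<times> 'b::euclidean_space \<Rightarrow> real"
  assumes f: "f \<in> cond_domain \<delta> B" and B: "open B" "bounded B" and \<delta>: "\<delta> > 0"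
  shows "integrable (lebesgue_on (UNIV \<times> B)) (kernel_conditioning B f)"
proof -
  obtain g m where g: "g \<in> borel_measurable lborel" and m: "m \<in> borel_measurable lborel"
    and fg: "AE z in lborel. f z = g z"
    and int: "AE y in lborel. integrable lborel (\<lambda>x. g (x, y)) \<and> m y = (\<integral>x. g (x, y) \<partial>lborel)"
    and nonneg: "AE y in lborel. AE x in lborel. 0 \<le> g (x, y)"
    and pos: "AE y in lborel. y \<in> B \<longrightarrow> \<delta> / 2 < m y"
    and eq: "AE z in lborel. z \<in> UNIV \<times> B \<longrightarrow> kernel_conditioning B f z = g z / m (snd z)"
    by (rule cond_domain_borel_version[OF f B(1) \<delta>])
  have UB: "UNIV \<times> B \<in> sets borel" "UNIV \<times> B \<in> sets lebesgue" using B by (auto simp: open_Times)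
  have "(snd :: 'a \<times> 'b \<Rightarrow> 'b) \<in> borel_measurable borel"
    by (intro borel_measurable_continuous_onI continuous_intros)
  then have k: "(\<lambda>z. g z / m (snd z)) \<in> borel_measurable (lborel :: ('a \<times> 'b) measure)"
    using g m by simp
  have "(\<lambda>z. g z / m (snd z) * indicator (UNIV \<times> B) z) \<in> borel_measurable lebesgue"
    using UB(1) by (intro measurable_completion borel_measurable_times k borel_measurable_indicator) simp
  moreover have "AE z in lebesgue. g z / m (snd z) * indicator (UNIV \<times> B) z = indicator (UNIV \<times> B) z *\<^sub>R kernel_conditioning B f z"
    by (rule AE_completion) (use eq in \<open>eventually_elim, auto simp: indicator_def\<close>)
  ultimately have "(\<lambda>z. indicator (UNIV \<times> B) z *\<^sub>R kernel_conditioning B f z) \<in> borel_measurable lebesgue"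
    by (rule borel_measurable_AE)
  then have meas: "kernel_conditioning B f \<in> borel_measurable (lebesgue_on (UNIV \<times> B))"
    using UB by (subst borel_measurable_restrict_space_iff) auto
  have "(\<integral>\<^sup>+z. ennreal (norm (kernel_conditioning B f z)) \<partial>lebesgue_on (UNIV \<times> B)) =
      (\<integral>\<^sup>+y. (\<integral>\<^sup>+x. ennreal \<bar>g (x, y) / m (snd (x, y))\<bar> \<partial>lborel) * indicator B y \<partial>lborel)"
  proof (rule nn_integral_Times_lborel[OF B(1)])
    show "(\<lambda>z. ennreal \<bar>g z / m (snd z)\<bar>) \<in> borel_measurable lborel" using borel_measurable_abs[OF k] by simp
    show "AE z in lborel. z \<in> UNIV \<times> B \<longrightarrow> ennreal (norm (kernel_conditioning B f z)) = ennreal \<bar>g z / m (snd z)\<bar>"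
      using eq by eventually_elim auto
  qed
  also have "\<dots> = (\<integral>\<^sup>+y. indicator B y \<partial>lborel)"
  proof (rule nn_integral_cong_AE, use int nonneg pos in eventually_elim)
    case (elim y)
    show ?case
    proof (cases "y \<in> B")
      case True
      then have "m y > 0" using elim(3) \<delta> by simp
      have "(\<integral>\<^sup>+x. ennreal \<bar>g (x, y) / m y\<bar> \<partial>lborel) = (\<integral>\<^sup>+x. ennreal (g (x, y) / m y) \<partial>lborel)"
        by (rule nn_integral_cong_AE, use elim(2) in eventually_elim) (use \<open>m y > 0\<close> in auto)
      also have "\<dots> = ennreal (\<integral>x. g (x, y) / m y \<partial>lborel)"
        by (rule nn_integral_eq_integral) (use elim \<open>m y > 0\<close> in \<open>auto elim: eventually_mono\<close>)
      also have "\<dots> = 1" using elim(1) \<open>m y > 0\<close> by simp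
      finally show ?thesis using True by simp
    qed simp
  qed
  also have "\<dots> = emeasure lborel B" using B by simp
  also have "\<dots> < \<infinity>" by (rule emeasure_bounded_finite[OF B(2)])
  finally show ?thesis using meas by (intro integrableI_bounded) auto
qed

text \<open>Write \<open>g1 / m1 - g2 / m2 = (g1 - g2) / m1 + g2 * (m2 - m1) / (m1 * m2)\<close> and
  integrate over \<open>x\<close>. As \<open>g2\<close> has integral \<open>m2\<close>, the second
  term contributes \<open>\<bar>m2 - m1\<bar> / m1\<close>, which the first one dominates. The sum
  is at most \<open>2 * I / m1\<close>, and \<open>m1 > \<delta> / 2\<close> gives the
  constant.\<close>

lemma kernel_conditioning_lipschitz:
  fixes f1 f2 :: "'a::euclidean_space \<times> 'b::euclidean_space \<Rightarrow> real"
  assumes f1: "f1 \<in> cond_domain \<delta> B" and f2: "f2 \<in> cond_domain \<delta> B" and B: "open B" and \<delta>: "\<delta> > 0"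
  shows "L1_norm (UNIV \<times> B) (\<lambda>z. kernel_conditioning B f1 z - kernel_conditioning B f2 z)
    \<le> ennreal (4 / \<delta> * (\<integral>z. \<bar>f1 z - f2 z\<bar> \<partial>lebesgue))"
proof -
  obtain g1 m1 where g1: "g1 \<in> borel_measurable lborel" and m1: "m1 \<in> borel_measurable lborel"
    and fg1: "AE z in lborel. f1 z = g1 z"
    and int1: "AE y in lborel. integrable lborel (\<lambda>x. g1 (x, y)) \<and> m1 y = (\<integral>x. g1 (x, y) \<partial>lborel)"
    and nonneg1: "AE y in lborel. AE x in lborel. 0 \<le> g1 (x, y)"
    and pos1: "AE y in lborel. y \<in> B \<longrightarrow> \<delta> / 2 < m1 y"
    and eq1: "AE z in lborel. z \<in> UNIV \<times> B \<longrightarrow> kernel_conditioning B f1 z = g1 z / m1 (snd z)"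
    by (rule cond_domain_borel_version[OF f1 B \<delta>])
  obtain g2 m2 where g2: "g2 \<in> borel_measurable lborel" and m2: "m2 \<in> borel_measurable lborel"
    and fg2: "AE z in lborel. f2 z = g2 z"
    and int2: "AE y in lborel. integrable lborel (\<lambda>x. g2 (x, y)) \<and> m2 y = (\<integral>x. g2 (x, y) \<partial>lborel)"
    and nonneg2: "AE y in lborel. AE x in lborel. 0 \<le> g2 (x, y)"
    and pos2: "AE y in lborel. y \<in> B \<longrightarrow> \<delta> / 2 < m2 y"
    and eq2: "AE z in lborel. z \<in> UNIV \<times> B \<longrightarrow> kernel_conditioning B f2 z = g2 z / m2 (snd z)"
    by (rule cond_domain_borel_version[OF f2 B \<delta>])
  have "(snd :: 'a \<times> 'b \<Rightarrow> 'b) \<in> borel_measurable borel"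
    by (intro borel_measurable_continuous_onI continuous_intros)
  then have k: "(\<lambda>z. ennreal \<bar>g1 z / m1 (snd z) - g2 z / m2 (snd z)\<bar>) \<in> borel_measurable (lborel :: ('a \<times> 'b) measure)"
    using g1 m1 g2 m2 by simp
  have diff: "(\<lambda>z. ennreal \<bar>g1 z - g2 z\<bar>) \<in> borel_measurable (lborel \<Otimes>\<^sub>M lborel)"
    using g1 g2 by (simp add: lborel_prod)
  have "L1_norm (UNIV \<times> B) (\<lambda>z. kernel_conditioning B f1 z - kernel_conditioning B f2 z) =
      (\<integral>\<^sup>+y. (\<integral>\<^sup>+x. ennreal \<bar>g1 (x, y) / m1 (snd (x, y)) - g2 (x, y) / m2 (snd (x, y))\<bar> \<partial>lborel) * indicator B y \<partial>lborel)"
    unfolding L1_norm_def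
    by (intro nn_integral_Times_lborel[OF B k]) (use eq1 eq2 in \<open>eventually_elim, auto\<close>)
  also have "\<dots> \<le> (\<integral>\<^sup>+y. ennreal (4 / \<delta>) * (\<integral>\<^sup>+x. ennreal \<bar>g1 (x, y) - g2 (x, y)\<bar> \<partial>lborel) \<partial>lborel)"
  proof (rule nn_integral_mono_AE, use int1 pos1 int2 nonneg2 pos2 in eventually_elim)
    case (elim y)
    show ?case
    proof (cases "y \<in> B")
      case True
      then have m: "m1 y > \<delta> / 2" "m2 y > 0" using elim(2,5) \<delta> by auto
      then have m1: "m1 y > 0" using \<delta> by auto
      define I where "I = (\<integral>x. \<bar>g1 (x, y) - g2 (x, y)\<bar> \<partial>lborel)"
      have I: "\<bar>m2 y - m1 y\<bar> \<le> I"
      proof -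
        have "m2 y - m1 y = (\<integral>x. g2 (x, y) - g1 (x, y) \<partial>lborel)" using elim by simp
        also have "\<bar>\<dots>\<bar> \<le> I" unfolding I_def
          using elim by (intro integral_abs_bound_integral) auto
        finally show ?thesis .
      qed
      have int: "integrable lborel (\<lambda>x. \<bar>g1 (x, y) - g2 (x, y)\<bar> / m1 y + g2 (x, y) * (\<bar>m2 y - m1 y\<bar> / (m1 y * m2 y)))"
        using elim by auto
      have "(\<integral>\<^sup>+x. ennreal \<bar>g1 (x, y) / m1 y - g2 (x, y) / m2 y\<bar> \<partial>lborel) \<le>
          (\<integral>\<^sup>+x. ennreal (\<bar>g1 (x, y) - g2 (x, y)\<bar> / m1 y + g2 (x, y) * (\<bar>m2 y - m1 y\<bar> / (m1 y * m2 y))) \<partial>lborel)"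
      proof (rule nn_integral_mono_AE, use elim(4) in eventually_elim)
        case (elim x)
        have "g1 (x, y) / m1 y - g2 (x, y) / m2 y =
            (g1 (x, y) - g2 (x, y)) / m1 y + g2 (x, y) * ((m2 y - m1 y) / (m1 y * m2 y))"
          using m1 m(2) by (simp add: field_simps)
        also have "\<bar>\<dots>\<bar> \<le> \<bar>(g1 (x, y) - g2 (x, y)) / m1 y\<bar> + \<bar>g2 (x, y) * ((m2 y - m1 y) / (m1 y * m2 y))\<bar>"
          by (rule abs_triangle_ineq)
        also have "\<dots> = \<bar>g1 (x, y) - g2 (x, y)\<bar> / m1 y + g2 (x, y) * (\<bar>m2 y - m1 y\<bar> / (m1 y * m2 y))"
          using elim m1 m(2) by (simp add: abs_mult)
        finally show ?case by (rule ennreal_leI)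
      qed
      also have "\<dots> = ennreal (\<integral>x. \<bar>g1 (x, y) - g2 (x, y)\<bar> / m1 y + g2 (x, y) * (\<bar>m2 y - m1 y\<bar> / (m1 y * m2 y)) \<partial>lborel)"
      proof (rule nn_integral_eq_integral[OF int])
        show "AE x in lborel. 0 \<le> \<bar>g1 (x, y) - g2 (x, y)\<bar> / m1 y + g2 (x, y) * (\<bar>m2 y - m1 y\<bar> / (m1 y * m2 y))"
          using elim(4) by eventually_elim (use m1 m(2) in auto)
      qed
      also have "(\<integral>x. \<bar>g1 (x, y) - g2 (x, y)\<bar> / m1 y + g2 (x, y) * (\<bar>m2 y - m1 y\<bar> / (m1 y * m2 y)) \<partial>lborel) =
          I / m1 y + m2 y * (\<bar>m2 y - m1 y\<bar> / (m1 y * m2 y))"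
        using elim by (subst Bochner_Integration.integral_add) (auto simp: I_def)
      also have "\<dots> = (I + \<bar>m2 y - m1 y\<bar>) / m1 y" using m1 m(2) by (simp add: field_simps)
      also have "\<dots> \<le> 2 * I / m1 y" using m1 I by (intro divide_right_mono) auto
      also have "\<dots> \<le> 2 * I / (\<delta> / 2)"
        using m \<delta> m1 by (intro divide_left_mono) (auto simp: I_def)
      also have "2 * I / (\<delta> / 2) = 4 / \<delta> * I" by simp
      also have "ennreal (4 / \<delta> * I) = ennreal (4 / \<delta>) * ennreal I" using \<delta> by (subst ennreal_mult) (auto simp: I_def)
      also have "ennreal I = (\<integral>\<^sup>+x. ennreal \<bar>g1 (x, y) - g2 (x, y)\<bar> \<partial>lborel)"
        unfolding I_def using elim by (intro nn_integral_eq_integral[symmetric]) auto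
      finally show ?thesis using True by (simp add: ennreal_leI)
    qed simp
  qed
  also have "\<dots> = ennreal (4 / \<delta>) * (\<integral>\<^sup>+y. (\<integral>\<^sup>+x. ennreal \<bar>g1 (x, y) - g2 (x, y)\<bar> \<partial>lborel) \<partial>lborel)"
    using lborel.borel_measurable_nn_integral_fst[OF measurable_pair_swap[OF diff]]
    by (intro nn_integral_cmult) simp
  also have "(\<integral>\<^sup>+y. (\<integral>\<^sup>+x. ennreal \<bar>g1 (x, y) - g2 (x, y)\<bar> \<partial>lborel) \<partial>lborel) = (\<integral>\<^sup>+z. ennreal \<bar>g1 z - g2 z\<bar> \<partial>lborel)"
    using lborel_pair.nn_integral_snd[OF diff] by (simp add: lborel_prod)
  also have "\<dots> = (\<integral>\<^sup>+z. ennreal \<bar>f1 z - f2 z\<bar> \<partial>lborel)"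
    by (rule nn_integral_cong_AE) (use fg1 fg2 in \<open>eventually_elim, auto\<close>)
  also have "\<dots> = (\<integral>\<^sup>+z. ennreal \<bar>f1 z - f2 z\<bar> \<partial>lebesgue)" by (simp add: nn_integral_completion)
  also have "\<dots> = ennreal (\<integral>z. \<bar>f1 z - f2 z\<bar> \<partial>lebesgue)"
    using f1 f2 by (intro nn_integral_eq_integral)
      (auto simp: cond_domain_def densities_def L1_def lebesgue_on_UNIV_eq)
  also have "ennreal (4 / \<delta>) * \<dots> = ennreal (4 / \<delta> * (\<integral>z. \<bar>f1 z - f2 z\<bar> \<partial>lebesgue))"
    using \<delta> by (subst ennreal_mult) auto
  finally show ?thesis .
qed


section \<open>Approximation of the kernel\<close>

text \<open>
  ReLU networks cannot multiply, but the product with an indicator is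
  \<open>\<chi> * indicator P x = relu (\<chi> + indicator P x - 1)\<close> as long as \<open>0 \<le> \<chi> \<le> 1\<close>.
\<close>

definition gateable :: "(real \<Rightarrow> real) \<Rightarrow> ('a::euclidean_space \<Rightarrow> real) \<Rightarrow> bool" where
  "gateable \<sigma> g \<longleftrightarrow> integrable lebesgue g \<and> (\<exists>S. bounded S \<and> (\<forall>x. x \<notin> S \<longrightarrow> g x = 0)) \<and>
     (\<forall>\<chi>. (\<lambda>(f, x). \<chi> f) \<in> relu_hull (neurons \<sigma> :: (('a \<Rightarrow> real) \<times> 'a \<Rightarrow> real) set) \<longrightarrow>
        (\<forall>f. 0 \<le> \<chi> f \<and> \<chi> f \<le> 1) \<longrightarrow> (\<lambda>(f, x). \<chi> f * g x) \<in> relu_hull (neurons \<sigma>))"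

text \<open>The unit cube has measure \<open>1\<close>, so the weight \<open>s - t\<close> and the
  bias \<open>t\<close> give a neuron that equals \<open>\<sigma> s\<close> on \<open>P\<close> and
  \<open>\<sigma> t\<close> elsewhere. An affine map turns these values into \<open>1\<close> and
  \<open>0\<close>.\<close>

lemma indicator_relu_hull:
  fixes P :: "'a::euclidean_space set"
  assumes \<sigma>: "\<sigma> s \<noteq> \<sigma> t" and P: "P \<in> sets lebesgue"
  shows "(\<lambda>(f, x). indicator P x) \<in> relu_hull (neurons \<sigma> :: (('a \<Rightarrow> real) \<times> 'a \<Rightarrow> real) set)"
proof -
  let ?u = "neuron \<sigma> False (cbox 0 One) P (s - t) t :: ('a \<Rightarrow> real) \<times> 'a \<Rightarrow> real"
  have "moment False (cbox 0 One :: 'a set) f = 1" for f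
    by (simp add: moment_def)
  then have u: "?u (f, x) = (if x \<in> P then \<sigma> s else \<sigma> t)" for f x
    by (simp add: neuron_def)
  have "bounded (cbox 0 One :: 'a set)" "(cbox 0 One :: 'a set) \<in> sets lebesgue" by auto
  then have "?u \<in> neurons \<sigma>" unfolding neurons_def using P by blast
  then have "(\<lambda>p. 1 / (\<sigma> s - \<sigma> t) * (?u p - \<sigma> t)) \<in> relu_hull (neurons \<sigma>)"
    by (intro relu_hull.scale relu_hull_diff relu_hull.const relu_hull.base)
  also have "(\<lambda>p. 1 / (\<sigma> s - \<sigma> t) * (?u p - \<sigma> t)) = (\<lambda>(f, x). indicator P x)"
    using \<sigma> by (auto simp: fun_eq_iff u)
  finally show ?thesis .
qed

lemma gateable_indicator:
  fixes P :: "'a::euclidean_space set"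
  assumes \<sigma>: "\<sigma> s \<noteq> \<sigma> t" and P: "P \<in> sets lebesgue" "bounded P"
  shows "gateable \<sigma> (indicator P)"
  unfolding gateable_def
proof (intro conjI allI impI)
  have "P \<in> lmeasurable" using P by (simp add: bounded_set_imp_lmeasurable)
  then show "integrable lebesgue (indicator P :: 'a \<Rightarrow> real)"
    by (intro integrable_real_indicator) (auto simp: fmeasurable_def)
  show "\<exists>S. bounded S \<and> (\<forall>x. x \<notin> S \<longrightarrow> indicator P x = (0 :: real))" using P(2) by auto
  fix \<chi> assume \<chi>: "(\<lambda>(f, x). \<chi> f) \<in> relu_hull (neurons \<sigma> :: (('a \<Rightarrow> real) \<times> 'a \<Rightarrow> real) set)"
    "\<forall>f. 0 \<le> \<chi> f \<and> \<chi> f \<le> 1"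
  have "(\<lambda>p. relu ((case p of (f, x) \<Rightarrow> \<chi> f) + (case p of (f, x) \<Rightarrow> indicator P x) - 1)) \<in> relu_hull (neurons \<sigma>)"
    by (intro relu_hull.relu relu_hull_diff relu_hull.add relu_hull.const \<chi>(1) indicator_relu_hull[of \<sigma>, OF \<sigma> P(1)])
  also have "(\<lambda>p. relu ((case p of (f, x) \<Rightarrow> \<chi> f) + (case p of (f, x) \<Rightarrow> indicator P x) - 1)) =
      (\<lambda>(f, x). \<chi> f * indicator P x)"
    using \<chi>(2) by (auto simp: fun_eq_iff relu_def indicator_def)
  finally show "(\<lambda>(f, x). \<chi> f * indicator P x) \<in> relu_hull (neurons \<sigma>)" .
qed

lemma gateable_scale:
  assumes "gateable \<sigma> g"
  shows "gateable \<sigma> (\<lambda>x. c * g x)"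
  unfolding gateable_def
proof (intro conjI allI impI)
  show "integrable lebesgue (\<lambda>x. c * g x)" "\<exists>S. bounded S \<and> (\<forall>x. x \<notin> S \<longrightarrow> c * g x = 0)"
    using assms by (auto simp: gateable_def)
  fix \<chi> assume "(\<lambda>(f, x). \<chi> f) \<in> relu_hull (neurons \<sigma> :: (('a \<Rightarrow> real) \<times> 'a \<Rightarrow> real) set)"
    "\<forall>f. 0 \<le> \<chi> f \<and> \<chi> f \<le> 1"
  then have "(\<lambda>(f, x). \<chi> f * g x) \<in> relu_hull (neurons \<sigma>)" using assms by (simp add: gateable_def)
  from relu_hull.scale[OF this, of c] show "(\<lambda>(f, x). \<chi> f * (c * g x)) \<in> relu_hull (neurons \<sigma>)"
    by (simp add: case_prod_unfold mult.left_commute)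
qed

lemma gateable_add:
  assumes "gateable \<sigma> g" and "gateable \<sigma> h"
  shows "gateable \<sigma> (\<lambda>x. g x + h x)"
  unfolding gateable_def
proof (intro conjI allI impI)
  show "integrable lebesgue (\<lambda>x. g x + h x)" using assms by (simp add: gateable_def)
  obtain S T where "bounded S" "\<And>x. x \<notin> S \<Longrightarrow> g x = 0" "bounded T" "\<And>x. x \<notin> T \<Longrightarrow> h x = 0"
    using assms unfolding gateable_def by blast
  then show "\<exists>S. bounded S \<and> (\<forall>x. x \<notin> S \<longrightarrow> g x + h x = 0)" by (intro exI[of _ "S \<union> T"]) auto
  fix \<chi> assume "(\<lambda>(f, x). \<chi> f) \<in> relu_hull (neurons \<sigma> :: (('a \<Rightarrow> real) \<times> 'a \<Rightarrow> real) set)"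
    "\<forall>f. 0 \<le> \<chi> f \<and> \<chi> f \<le> 1"
  then have "(\<lambda>(f, x). \<chi> f * g x) \<in> relu_hull (neurons \<sigma>)" "(\<lambda>(f, x). \<chi> f * h x) \<in> relu_hull (neurons \<sigma>)"
    using assms by (simp_all add: gateable_def)
  from relu_hull.add[OF this] show "(\<lambda>(f, x). \<chi> f * (g x + h x)) \<in> relu_hull (neurons \<sigma>)"
    by (simp add: case_prod_unfold distrib_left)
qed

text \<open>Intersections with growing cubes, by dominated convergence.\<close>

lemma indicator_bounded_approx:
  fixes A :: "'a::euclidean_space set"
  assumes A: "A \<in> sets lebesgue" "emeasure lebesgue A < \<infinity>" and "e > 0"
  obtains P where "P \<in> sets lebesgue" "bounded P" "(\<integral>x. \<bar>indicator A x - indicator P x\<bar> \<partial>lebesgue) < (e::real)"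
proof -
  have int: "integrable lebesgue (indicator A :: 'a \<Rightarrow> real)" using A by simp
  define P :: "nat \<Rightarrow> 'a set" where "P n = A \<inter> open_cube (real n)" for n
  have P: "P n \<in> sets lebesgue" "bounded (P n)" for n
    using A sets_open_cube bounded_subset[OF bounded_open_cube] by (auto simp: P_def)
  have "(\<lambda>n. \<integral>x. \<bar>indicator A x - indicator (P n) x\<bar> \<partial>lebesgue) \<longlonglongrightarrow> (\<integral>x. (0::real) \<partial>(lebesgue :: 'a measure))"
  proof (rule integral_dominated_convergence[where w = "indicator A"])
    show "AE x in lebesgue. (\<lambda>n. \<bar>indicator A x - indicator (P n) x\<bar>) \<longlonglongrightarrow> (0::real)"
    proof (rule AE_I2)
      fix x :: 'a
      obtain R where R: "R > 0" "{x} \<subseteq> open_cube R" using bounded_subset_open_cube[of "{x}"] by auto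
      have "\<forall>\<^sub>F n in sequentially. \<bar>indicator A x - indicator (P n) x\<bar> = (0::real)"
        using eventually_ge_at_top[of "nat \<lceil>R\<rceil>"]
      proof eventually_elim
        case (elim n)
        then have "R \<le> real n" by linarith
        then have "x \<in> open_cube (real n)" using R(2) by (force simp: mem_open_cube)
        then show ?case by (simp add: P_def indicator_def)
      qed
      then show "(\<lambda>n. \<bar>indicator A x - indicator (P n) x\<bar>) \<longlonglongrightarrow> (0::real)" by (rule tendsto_eventually)
    qed
    show "AE x in lebesgue. norm \<bar>indicator A x - indicator (P n) x :: real\<bar> \<le> indicator A x" for n
      by (rule AE_I2) (auto simp: P_def indicator_def)
    show "(\<lambda>x. \<bar>indicator A x - indicator (P n) x\<bar> :: real) \<in> borel_measurable lebesgue" for n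
      using A P by (intro borel_measurable_abs borel_measurable_diff borel_measurable_indicator)
  qed (use int in auto)
  then have "\<forall>\<^sub>F n in sequentially. (\<integral>x. \<bar>indicator A x - indicator (P n) x\<bar> \<partial>lebesgue) < e"
    using \<open>e > 0\<close> by (auto dest: order_tendstoD(2))
  then obtain n where "(\<integral>x. \<bar>indicator A x - indicator (P n) x\<bar> \<partial>lebesgue) < e"
    by (auto simp: eventually_sequentially)
  with P that show thesis by blast
qed

lemma gateable_dense:
  fixes h :: "'a::euclidean_space \<Rightarrow> real"
  assumes \<sigma>: "\<sigma> s \<noteq> \<sigma> t" and h: "integrable lebesgue h" and "e > 0"
  shows "\<exists>g. gateable \<sigma> g \<and> (\<integral>x. \<bar>h x - g x\<bar> \<partial>lebesgue) < e"
  using h \<open>e > 0\<close>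
proof (induction arbitrary: e rule: integrable_induct)
  case (base A c)
  \<comment> \<open>The error is scaled by \<open>\<bar>c\<bar>\<close>; adding \<open>1\<close> in
    the denominator covers \<open>c = 0\<close> and makes the final inequality strict.\<close>
  obtain P where P: "P \<in> sets lebesgue" "bounded P"
    "(\<integral>x. \<bar>indicator A x - indicator P x\<bar> \<partial>lebesgue) < e / (\<bar>c\<bar> + 1)"
    using indicator_bounded_approx[OF base(1,2), of "e / (\<bar>c\<bar> + 1)"] base(3) by auto
  have "(\<integral>x. \<bar>indicator A x *\<^sub>R c - c * indicator P x\<bar> \<partial>lebesgue) =
      (\<integral>x. \<bar>c\<bar> * \<bar>indicator A x - indicator P x\<bar> \<partial>lebesgue)"
    by (rule Bochner_Integration.integral_cong) (simp_all add: mult.commute flip: abs_mult right_diff_distrib)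
  also have "\<dots> = \<bar>c\<bar> * (\<integral>x. \<bar>indicator A x - indicator P x\<bar> \<partial>lebesgue)" by simp
  also have "\<dots> \<le> \<bar>c\<bar> * (e / (\<bar>c\<bar> + 1))" using P(3) by (intro mult_left_mono) auto
  also have "\<dots> < e" using base(3) by (simp add: field_simps)
  finally show ?case using gateable_scale[OF gateable_indicator[of \<sigma>, OF \<sigma> P(1,2)], of c] by blast
next
  case (add f1 f2)
  obtain g1 where g1: "gateable \<sigma> g1" "(\<integral>x. \<bar>f1 x - g1 x\<bar> \<partial>lebesgue) < e / 2"
    using add.IH(1)[of "e / 2"] add.prems by auto
  obtain g2 where g2: "gateable \<sigma> g2" "(\<integral>x. \<bar>f2 x - g2 x\<bar> \<partial>lebesgue) < e / 2"
    using add.IH(2)[of "e / 2"] add.prems by auto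
  have int: "integrable lebesgue g1" "integrable lebesgue g2" using g1 g2 by (auto simp: gateable_def)
  have "(\<integral>x. \<bar>f1 x + f2 x - (g1 x + g2 x)\<bar> \<partial>lebesgue) \<le> (\<integral>x. \<bar>f1 x - g1 x\<bar> + \<bar>f2 x - g2 x\<bar> \<partial>lebesgue)"
    using add.hyps int by (intro integral_mono) auto
  also have "\<dots> = (\<integral>x. \<bar>f1 x - g1 x\<bar> \<partial>lebesgue) + (\<integral>x. \<bar>f2 x - g2 x\<bar> \<partial>lebesgue)"
    using add.hyps int by (intro Bochner_Integration.integral_add) auto
  also have "\<dots> < e" using g1(2) g2(2) by simp
  finally show ?case using gateable_add[OF g1(1) g2(1)] by blast
next
  case (lim f s)
  have "(\<lambda>i. \<integral>x. \<bar>f x - s i x\<bar> \<partial>lebesgue) \<longlonglongrightarrow> (\<integral>x. (0::real) \<partial>(lebesgue :: 'a measure))"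
  proof (rule integral_dominated_convergence[where w = "\<lambda>x. 3 * norm (f x)"])
    have "(\<lambda>i. \<bar>f x - s i x\<bar>) \<longlonglongrightarrow> 0" for x
      using tendsto_rabs[OF tendsto_diff[OF tendsto_const lim.hyps(2)], of x "f x"] by simp
    then show "AE x in lebesgue. (\<lambda>i. \<bar>f x - s i x\<bar>) \<longlonglongrightarrow> 0" by simp
    \<comment> \<open>The approximants satisfy \<open>norm (s i x) \<le> 2 * norm (f x)\<close>,
      whence the factor \<open>3\<close>.\<close>
    show "AE x in lebesgue. norm \<bar>f x - s i x\<bar> \<le> 3 * norm (f x)" for i
    proof (rule AE_I2)
      fix x :: 'a
      show "norm \<bar>f x - s i x\<bar> \<le> 3 * norm (f x)"
        using lim.hyps(3)[of x i] by simp
    qed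
  qed (use lim.hyps in auto)
  then have "\<forall>\<^sub>F i in sequentially. (\<integral>x. \<bar>f x - s i x\<bar> \<partial>lebesgue) < e / 2"
    using lim.prems by (intro order_tendstoD(2)) auto
  then obtain i where i: "(\<integral>x. \<bar>f x - s i x\<bar> \<partial>lebesgue) < e / 2"
    by (auto simp: eventually_sequentially)
  obtain g where g: "gateable \<sigma> g" "(\<integral>x. \<bar>s i x - g x\<bar> \<partial>lebesgue) < e / 2"
    using lim.IH[of "e / 2" i] lim.prems by auto
  have "(\<integral>x. \<bar>f x - g x\<bar> \<partial>lebesgue) \<le> (\<integral>x. \<bar>f x - s i x\<bar> \<partial>lebesgue) + (\<integral>x. \<bar>s i x - g x\<bar> \<partial>lebesgue)"
    using L1_dist_triangle[of f UNIV "s i" g] lim.hyps g(1)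
    by (simp add: integrable_L1_UNIV lebesgue_on_UNIV_eq gateable_def)
  with i g show ?case by (intro exI[of _ g]) simp
qed

section \<open>Norm estimates and the final assembly\<close>

text \<open>Density is used on the whole space, for the kernel extended by zero. Returning to
  \<open>A\<close> only discards the mass of \<open>g\<close> outside.\<close>

lemma L1_norm_le_integral_UNIV:
  assumes h: "integrable (lebesgue_on A) h" and A: "A \<in> sets lebesgue" and g: "integrable lebesgue g"
  shows "L1_norm A (\<lambda>x. h x - g x) \<le> ennreal (\<integral>x. \<bar>indicator A x * h x - g x\<bar> \<partial>lebesgue)"
proof -
  have int: "integrable lebesgue (\<lambda>x. indicator A x * h x)"
    using h A by (simp add: integrable_restrict_space)
  have "L1_norm A (\<lambda>x. h x - g x) = (\<integral>\<^sup>+x. ennreal \<bar>h x - g x\<bar> * indicator A x \<partial>lebesgue)"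
    unfolding L1_norm_def using A by (subst nn_integral_restrict_space) auto
  also have "\<dots> \<le> (\<integral>\<^sup>+x. ennreal \<bar>indicator A x * h x - g x\<bar> \<partial>lebesgue)"
    by (intro nn_integral_mono) (auto simp: indicator_def)
  also have "\<dots> = ennreal (\<integral>x. \<bar>indicator A x * h x - g x\<bar> \<partial>lebesgue)"
    using int g by (intro nn_integral_eq_integral) auto
  finally show ?thesis .
qed

lemma L1_norm_triangle:
  assumes "f \<in> borel_measurable (lebesgue_on \<Omega>)" "g \<in> borel_measurable (lebesgue_on \<Omega>)" "h \<in> borel_measurable (lebesgue_on \<Omega>)"
  shows "L1_norm \<Omega> (\<lambda>x. f x - h x) \<le> L1_norm \<Omega> (\<lambda>x. f x - g x) + L1_norm \<Omega> (\<lambda>x. g x - h x)"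
proof -
  have "L1_norm \<Omega> (\<lambda>x. f x - h x) \<le> (\<integral>\<^sup>+x. ennreal \<bar>f x - g x\<bar> + ennreal \<bar>g x - h x\<bar> \<partial>lebesgue_on \<Omega>)"
    unfolding L1_norm_def by (intro nn_integral_mono) (simp flip: ennreal_plus)
  also have "\<dots> = L1_norm \<Omega> (\<lambda>x. f x - g x) + L1_norm \<Omega> (\<lambda>x. g x - h x)"
    unfolding L1_norm_def using assms by (intro nn_integral_add) auto
  finally show ?thesis .
qed

text \<open>Since the weights sum to \<open>1\<close>, the error is bounded by the weighted mean of
  the individual errors. Only indices with \<open>c k \<noteq> 0\<close> are constrained, that is,
  pieces whose centre is near \<open>f\<close>.\<close>

lemma L1_norm_convex_combination:
  assumes f: "f \<in> borel_measurable (lebesgue_on \<Omega>)" and g: "\<And>k. k < n \<Longrightarrow> g k \<in> borel_measurable (lebesgue_on \<Omega>)"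
    and c: "\<And>k. k < n \<Longrightarrow> 0 \<le> c k" "(\<Sum>k<n. c k) = 1"
    and le: "\<And>k. k < n \<Longrightarrow> c k \<noteq> 0 \<Longrightarrow> L1_norm \<Omega> (\<lambda>x. f x - g k x) \<le> ennreal e"
    and e: "e \<ge> 0"
  shows "L1_norm \<Omega> (\<lambda>x. f x - (\<Sum>k<n. c k * g k x)) \<le> ennreal e"
proof -
  have "\<bar>f x - (\<Sum>k<n. c k * g k x)\<bar> \<le> (\<Sum>k<n. c k * \<bar>f x - g k x\<bar>)" for x
  proof -
    have "f x - (\<Sum>k<n. c k * g k x) = (\<Sum>k<n. c k * (f x - g k x))"
      using c(2) by (simp add: right_diff_distrib sum_subtractf flip: sum_distrib_right)
    also have "\<bar>\<dots>\<bar> \<le> (\<Sum>k<n. \<bar>c k * (f x - g k x)\<bar>)" by (rule sum_abs)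
    also have "\<dots> = (\<Sum>k<n. c k * \<bar>f x - g k x\<bar>)" using c(1) by (intro sum.cong) (auto simp: abs_mult)
    finally show ?thesis .
  qed
  then have "L1_norm \<Omega> (\<lambda>x. f x - (\<Sum>k<n. c k * g k x)) \<le>
      (\<integral>\<^sup>+x. ennreal (\<Sum>k<n. c k * \<bar>f x - g k x\<bar>) \<partial>lebesgue_on \<Omega>)"
    unfolding L1_norm_def by (intro nn_integral_mono ennreal_leI)
  also have "\<dots> = (\<integral>\<^sup>+x. (\<Sum>k<n. ennreal (c k) * ennreal \<bar>f x - g k x\<bar>) \<partial>lebesgue_on \<Omega>)"
    using c(1) by (intro nn_integral_cong) (subst sum_ennreal[symmetric], auto intro!: sum.cong simp: ennreal_mult)
  also have "\<dots> = (\<Sum>k<n. \<integral>\<^sup>+x. ennreal (c k) * ennreal \<bar>f x - g k x\<bar> \<partial>lebesgue_on \<Omega>)"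
    using f g by (intro nn_integral_sum) auto
  also have "\<dots> = (\<Sum>k<n. ennreal (c k) * L1_norm \<Omega> (\<lambda>x. f x - g k x))"
    unfolding L1_norm_def using f g by (intro sum.cong nn_integral_cmult) auto
  also have "\<dots> \<le> (\<Sum>k<n. ennreal (c k) * ennreal e)"
  proof (intro sum_mono)
    fix k assume "k \<in> {..<n}"
    then show "ennreal (c k) * L1_norm \<Omega> (\<lambda>x. f x - g k x) \<le> ennreal (c k) * ennreal e"
      using le[of k] by (cases "c k = 0") (auto intro: mult_left_mono)
  qed
  also have "\<dots> = ennreal e"
    unfolding sum_distrib_right[symmetric] using c by (subst sum_ennreal) auto
  finally show ?thesis .
qed

theorem corollary3p12:
  fixes \<epsilon> \<delta> :: real
    and B :: "(real ^ 'r) set"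
    and K :: "((real ^ 'm) \<times> (real ^ 'r) \<Rightarrow> real) set"
    and \<sigma> :: "real \<Rightarrow> real"
  assumes "0 < \<epsilon>" and "0 < \<delta>"
    and "bounded B" and "open B" and "B \<in> sets lebesgue"
    and "K \<subseteq> cond_domain \<delta> B"
    and "compactin (L1_topology UNIV) K"
    and "nonlinearity \<sigma>"
  shows "\<exists>R>0. \<exists>\<Psi>. full_space_neural_operator \<sigma> (open_cube R) \<Psi> \<and>
    (SUP \<rho>\<in>K. L1_norm (UNIV \<times> B) (\<lambda>z. kernel_conditioning B \<rho> z - \<Psi> \<rho> z)) \<le> ennreal \<epsilon>"
proof -
  let ?k = "kernel_conditioning B :: ((real ^ 'm) \<times> (real ^ 'r) \<Rightarrow> real) \<Rightarrow> _"
  let ?\<Omega> = "UNIV \<times> B :: ((real ^ 'm) \<times> (real ^ 'r)) set"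
  let ?H = "relu_hull (neurons \<sigma>) :: (((real ^ 'm) \<times> (real ^ 'r) \<Rightarrow> real) \<times> (real ^ 'm) \<times> (real ^ 'r) \<Rightarrow> real) set"
  have \<sigma>: "continuous_on UNIV \<sigma>" using assms(8) by (simp add: nonlinearity_def)
  obtain s t where st: "\<sigma> s \<noteq> \<sigma> t"
  proof -
    have "\<exists>t. \<sigma> t \<noteq> 0 * t + \<sigma> 0" using assms(8) unfolding nonlinearity_def by blast
    then show thesis using that by auto
  qed
  have \<Omega>: "?\<Omega> \<in> sets lebesgue" using assms(4) by (auto simp: open_Times)
  have int: "integrable (lebesgue_on ?\<Omega>) (?k \<rho>)" if "\<rho> \<in> K" for \<rho>
    using integrable_kernel_conditioning assms that by blast
  \<comment> \<open>Chosen so that the Lipschitz constant \<open>4 / \<delta>\<close> times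
    \<open>\<eta>\<close> is \<open>\<epsilon> / 2\<close>.\<close>
  define \<eta> where "\<eta> = \<epsilon> * \<delta> / 8"
  have "\<eta> > 0" using assms by (simp add: \<eta>_def)
  obtain n :: nat and c \<chi> where c: "\<And>k. k < n \<Longrightarrow> c k \<in> K"
    and \<chi>: "\<And>k. k < n \<Longrightarrow> (\<lambda>(f, x). \<chi> k f) \<in> ?H"
    and \<chi>01: "\<And>k f. k < n \<Longrightarrow> 0 \<le> \<chi> k f \<and> \<chi> k f \<le> 1"
    and \<chi>_sum: "\<And>f. f \<in> K \<Longrightarrow> (\<Sum>k<n. \<chi> k f) = 1"
    and \<chi>_near: "\<And>k f. k < n \<Longrightarrow> f \<in> K \<Longrightarrow> \<chi> k f \<noteq> 0 \<Longrightarrow> (\<integral>x. \<bar>f x - c k x\<bar> \<partial>lebesgue) < \<eta>"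
    by (rule relu_partition_of_unity[OF \<sigma> st assms(7) \<open>\<eta> > 0\<close>]) (rule that; assumption)
  have "\<forall>k\<in>{..<n}. \<exists>g. gateable \<sigma> g \<and> (\<integral>x. \<bar>indicator ?\<Omega> x * ?k (c k) x - g x\<bar> \<partial>lebesgue) < \<epsilon> / 2"
  proof
    fix k assume "k \<in> {..<n}"
    then show "\<exists>g. gateable \<sigma> g \<and> (\<integral>x. \<bar>indicator ?\<Omega> x * ?k (c k) x - g x\<bar> \<partial>lebesgue) < \<epsilon> / 2"
      using int[OF c[of k]] \<Omega> assms(1)
      by (intro gateable_dense[of \<sigma>, OF st]) (simp_all add: integrable_restrict_space)
  qed
  from bchoice[OF this] obtain g where g: "\<And>k. k < n \<Longrightarrow> gateable \<sigma> (g k)"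
    and g_approx: "\<And>k. k < n \<Longrightarrow> (\<integral>x. \<bar>indicator ?\<Omega> x * ?k (c k) x - g k x\<bar> \<partial>lebesgue) < \<epsilon> / 2"
    by auto
  have g_int: "integrable lebesgue (g k)" if "k < n" for k using g[OF that] by (simp add: gateable_def)
  have g_meas: "g k \<in> borel_measurable (lebesgue_on ?\<Omega>)" if "k < n" for k
    using g_int[OF that] by (intro measurable_restrict_space1) auto
  have "\<forall>k\<in>{..<n}. \<exists>S. bounded S \<and> (\<forall>x. x \<notin> S \<longrightarrow> g k x = 0)"
    using g by (simp add: gateable_def)
  from bchoice[OF this] obtain S where S: "\<And>k. k < n \<Longrightarrow> bounded (S k)" "\<And>k x. k < n \<Longrightarrow> x \<notin> S k \<Longrightarrow> g k x = 0"
    by auto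
  \<comment> \<open>The approximating combination as one function of \<open>(f, x)\<close>; each
    summand lies in the hull because \<open>g k\<close> is gateable and \<open>\<chi> k\<close>
    stays in the unit interval.\<close>
  define U where "U = (\<lambda>p. \<Sum>k<n. case p of (f, x) \<Rightarrow> \<chi> k f * g k x)"
  have "U \<in> ?H"
    unfolding U_def using g \<chi> \<chi>01 by (intro relu_hull_sum) (auto simp: gateable_def)
  moreover have "bounded (\<Union>k<n. S k)" using S(1) by auto
  ultimately obtain R \<Psi> where R: "R > 0" "(\<Union>k<n. S k) \<subseteq> open_cube R"
    and \<Psi>: "full_space_neural_operator \<sigma> (open_cube R) \<Psi>"
    and \<Psi>_eq: "\<And>f x. f \<in> L1 UNIV \<Longrightarrow> \<Psi> f x = (if x \<in> open_cube R then U (f, x) else 0)"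
    by (rule full_space_neural_operator_relu_hull[OF \<sigma>]) (rule that; assumption)
  have "L1_norm ?\<Omega> (\<lambda>z. ?k \<rho> z - \<Psi> \<rho> z) \<le> ennreal \<epsilon>" if \<rho>: "\<rho> \<in> K" for \<rho>
  proof -
    have "\<rho> \<in> L1 UNIV" using \<rho> assms(6) by (auto simp: cond_domain_def densities_def)
    \<comment> \<open>Truncation is exact: outside the cube every \<open>g k\<close>
      vanishes.\<close>
    have "\<Psi> \<rho> z = (\<Sum>k<n. \<chi> k \<rho> * g k z)" for z
    proof (cases "z \<in> open_cube R")
      case False
      then have "g k z = 0" if "k < n" for k using S(2)[OF that, of z] R(2) that by blast
      with False show ?thesis by (simp add: \<Psi>_eq[OF \<open>\<rho> \<in> L1 UNIV\<close>])
    qed (simp add: \<Psi>_eq[OF \<open>\<rho> \<in> L1 UNIV\<close>] U_def)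
    moreover have "L1_norm ?\<Omega> (\<lambda>z. ?k \<rho> z - (\<Sum>k<n. \<chi> k \<rho> * g k z)) \<le> ennreal \<epsilon>"
    proof (rule L1_norm_convex_combination)
      show "?k \<rho> \<in> borel_measurable (lebesgue_on ?\<Omega>)" using int[OF \<rho>] by auto
      fix k assume k: "k < n" "\<chi> k \<rho> \<noteq> 0"
      have "L1_norm ?\<Omega> (\<lambda>z. ?k \<rho> z - g k z) \<le>
          L1_norm ?\<Omega> (\<lambda>z. ?k \<rho> z - ?k (c k) z) + L1_norm ?\<Omega> (\<lambda>z. ?k (c k) z - g k z)"
        using int[OF \<rho>] int[OF c[OF k(1)]] g_meas[OF k(1)] by (intro L1_norm_triangle) auto
      also have "\<dots> \<le> ennreal (\<epsilon> / 2) + ennreal (\<epsilon> / 2)"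
      proof (rule add_mono)
        have "L1_norm ?\<Omega> (\<lambda>z. ?k \<rho> z - ?k (c k) z) \<le> ennreal (4 / \<delta> * (\<integral>x. \<bar>\<rho> x - c k x\<bar> \<partial>lebesgue))"
          using kernel_conditioning_lipschitz[of \<rho> \<delta> B "c k"] assms c[OF k(1)] \<rho> by blast
        also have "\<dots> \<le> ennreal (4 / \<delta> * \<eta>)"
          using \<chi>_near[OF k(1) \<rho> k(2)] assms(2) by (intro ennreal_leI mult_left_mono) auto
        also have "4 / \<delta> * \<eta> = \<epsilon> / 2" using assms(2) by (simp add: \<eta>_def)
        finally show "L1_norm ?\<Omega> (\<lambda>z. ?k \<rho> z - ?k (c k) z) \<le> ennreal (\<epsilon> / 2)" .
        show "L1_norm ?\<Omega> (\<lambda>z. ?k (c k) z - g k z) \<le> ennreal (\<epsilon> / 2)"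
          using L1_norm_le_integral_UNIV[OF int[OF c[OF k(1)]] \<Omega> g_int[OF k(1)]] g_approx[OF k(1)]
          by (auto elim!: order_trans intro: ennreal_leI)
      qed
      also have "\<dots> = ennreal \<epsilon>" using assms(1) by (simp flip: ennreal_plus)
      finally show "L1_norm ?\<Omega> (\<lambda>z. ?k \<rho> z - g k z) \<le> ennreal \<epsilon>" .
    qed (use g_meas \<chi>01 \<chi>_sum[OF \<rho>] assms(1) in auto)
    ultimately show ?thesis by simp
  qed
  then have "(SUP \<rho>\<in>K. L1_norm ?\<Omega> (\<lambda>z. ?k \<rho> z - \<Psi> \<rho> z)) \<le> ennreal \<epsilon>" by (rule SUP_least)
  with R(1) \<Psi> show ?thesis by blast
qed

end
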